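(* Let $X=(X_t)_{t\ge 0}$ be a Markov process with values in $\mathbb{R}^d$ satisfying the following condition X: the process $X$ possesses a transition probability density $p_t(x,y)$ that is differentiable with respect to $t$ and satisfies $$|\partial_t p_t(x,y)|\le C_T\, t^{-1} q_{t,x}(y),\qquad t\le T,\quad C_T\ge 1,$$ for some measurable function $q$ such that for any fixed $t$ and $x$ the function $q_{t,x}$ is a distribution density. Let $h$ be a measurable and bounded function on $\mathbb{R}^d$. Then for each $k\in\mathbb{N}$ and any bounded function $f$, $$\Big|E_x\big[(I_T(h))^k f(X_T)\big]-E_x\big[(I_{T,n}(h))^k f(X_T)\big]\Big|\le 6k^2\, C_T\, T^k\,\|h\|^k\left(\frac{\log n}{n}\right)\|f\|.$$
   Context: $E_x$ denotes expectation with respect to the law $P_x$ of the Markov process $X$ conditioned by $X_0=x$. The integral functional and its integral sums are $$I_T(h)=\int_0^T h(X_t)\,dt,\qquad I_{T,n}(h)=\frac{T}{n}\sum_{j=0}^{n-1}h(X_{jT/n}),\quad n\ge 1.$$ $\|\cdot\|$ denotes the sup-norm. No regularity of $h$ beyond measurability and boundedness is assumed.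
   Formalization: The bound is stated for n ≥ 2, since for n = 1 the right-hand side is 0 (log 1 = 0) and the inequality fails; f is taken Borel measurable and X jointly measurable in time and outcome, so that the expectations and I_T(h) are defined. *)

theory Defs
  imports "HOL-Probability.Probability"
begin

definition past :: "'w measure \<Rightarrow> (real \<Rightarrow> 'w \<Rightarrow> 'a :: topological_space) \<Rightarrow> real \<Rightarrow> 'w measure" where
  "past M X s =
     sigma (space M) {X u -` A \<inter> space M | u A. 0 \<le> u \<and> u \<le> s \<and> A \<in> sets borel}"

(* A time-homogeneous Markov process, given by one measurable space, one process X on it
   and the laws P x of X started at x.  The measure carried by M is irrelevant; only its
   space and sets are used.  The Markov property is stated for the natural filtration
   of X, i.e. in its weakest form. *)
locale markov_process =
  fixes M :: "'w measure"
    and P :: "real ^ 'd \<Rightarrow> 'w measure"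
    and X :: "real \<Rightarrow> 'w \<Rightarrow> real ^ 'd"
  assumes prob_space_P: "prob_space (P x)"
    and sets_P: "sets (P x) = sets M"
    and measurable_X: "t \<ge> 0 \<Longrightarrow> X t \<in> measurable M borel"
    and start: "AE \<omega> in P x. X 0 \<omega> = x"
    and measurable_kernel:
      "\<lbrakk>t \<ge> 0; A \<in> sets borel\<rbrakk>
         \<Longrightarrow> (\<lambda>x. measure (P x) (X t -` A \<inter> space M)) \<in> borel_measurable borel"
    and markov:
      "\<lbrakk>s \<ge> 0; t \<ge> 0; A \<in> sets borel\<rbrakk> \<Longrightarrow>
         AE \<omega> in P x. real_cond_exp (P x) (past M X s) (\<lambda>\<omega>'. indicator A (X (s + t) \<omega>')) \<omega>
                       = measure (P (X s \<omega>)) (X t -` A \<inter> space M)"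

definition measurable_process :: "'w measure \<Rightarrow> (real \<Rightarrow> 'w \<Rightarrow> 'a :: topological_space) \<Rightarrow> bool" where
  "measurable_process M X \<longleftrightarrow>
     (\<lambda>(t, \<omega>). X t \<omega>) \<in> borel_measurable (restrict_space borel {0..} \<Otimes>\<^sub>M M)"

definition transition_density ::
  "(real ^ 'd \<Rightarrow> 'w measure) \<Rightarrow> (real \<Rightarrow> 'w \<Rightarrow> real ^ 'd) \<Rightarrow>
     (real \<Rightarrow> real ^ 'd \<Rightarrow> real ^ 'd \<Rightarrow> real) \<Rightarrow> bool" where
  "transition_density P X p \<longleftrightarrow>
     (\<forall>t>0. \<forall>x. (\<forall>y. p t x y \<ge> 0) \<and> distributed (P x) lborel (X t) (\<lambda>y. ennreal (p t x y)))"

definition distribution_density :: "(real ^ 'd \<Rightarrow> real) \<Rightarrow> bool" where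
  "distribution_density g \<longleftrightarrow>
     g \<in> borel_measurable borel \<and> (\<forall>y. g y \<ge> 0) \<and> (\<integral>\<^sup>+ y. ennreal (g y) \<partial>lborel) = 1"

(* p and q are only meaningful at strictly positive times; the function C gives the constant C_T
   for each time horizon T, while q does not depend on T. *)
definition condition_X ::
  "(real ^ 'd \<Rightarrow> 'w measure) \<Rightarrow> (real \<Rightarrow> 'w \<Rightarrow> real ^ 'd) \<Rightarrow>
     (real \<Rightarrow> real ^ 'd \<Rightarrow> real ^ 'd \<Rightarrow> real) \<Rightarrow> (real \<Rightarrow> real) \<Rightarrow> bool" where
  "condition_X P X p C \<longleftrightarrow>
     transition_density P X p \<and>
     (\<forall>t>0. \<forall>x y. (\<lambda>s. p s x y) differentiable (at t)) \<and>
     (\<exists>q :: real \<Rightarrow> real ^ 'd \<Rightarrow> real ^ 'd \<Rightarrow> real.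
        (\<lambda>(t, x, y). q t x y)
          \<in> borel_measurable (restrict_space borel {0<..} \<Otimes>\<^sub>M borel \<Otimes>\<^sub>M borel) \<and>
        (\<forall>t>0. \<forall>x. distribution_density (q t x)) \<and>
        (\<forall>T>0. C T \<ge> 1 \<and>
          (\<forall>t x y. 0 < t \<and> t \<le> T \<longrightarrow>
             \<bar>deriv (\<lambda>s. p s x y) t\<bar> \<le> C T * (1 / t) * q t x y)))"

definition int_functional ::
  "(real \<Rightarrow> 'w \<Rightarrow> 'a) \<Rightarrow> ('a \<Rightarrow> real) \<Rightarrow> real \<Rightarrow> 'w \<Rightarrow> real" where
  "int_functional X h T \<omega> = (LBINT t:{0..T}. h (X t \<omega>))"

definition int_sum ::
  "(real \<Rightarrow> 'w \<Rightarrow> 'a) \<Rightarrow> ('a \<Rightarrow> real) \<Rightarrow> real \<Rightarrow> nat \<Rightarrow> 'w \<Rightarrow> real" where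
  "int_sum X h T n \<omega> = T / real n * (\<Sum>j<n. h (X (real j * T / real n) \<omega>))"

(* Meaningful for bounded g only. *)
definition sup_norm :: "('a \<Rightarrow> real) \<Rightarrow> real" where
  "sup_norm g = (SUP y. \<bar>g y\<bar>)"

end

theory Submission
  imports Defs
begin

text \<open>After division by \<open>T ^ k\<close>, both \<open>k\<close>-th powers are averages over \<open>k\<close> independent uniform times \<open>t\<^sub>i\<close> in
  \<open>[0, T)\<close>: of the product of the \<open>h (X t\<^sub>i)\<close>, respectively of the \<open>h (X s\<^sub>i)\<close>, where \<open>s\<^sub>i\<close> is the left end of the
  grid cell of \<open>t\<^sub>i\<close>.  The \<open>t\<^sub>i\<close> are replaced by \<open>s\<^sub>i\<close> one at a time, in increasing order, so that the sample times
  stay ordered.  By the Markov property one replacement costs the change in law of the increment since the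
  previous sample time plus that of the increment to the next one, and condition X bounds the change over one
  cell by \<open>min 2 (C\<^sub>T / m)\<close> up to constants, where \<open>m\<close> counts the full cells elapsed.  Bounding the neighbouring
  sample times by a sum over all of them leaves about \<open>k\<^sup>2\<close> pairs, and averaging over the cell of \<open>t\<^sub>i\<close> turns
  \<open>1 / m\<close> into a harmonic sum of order \<open>log n / n\<close>.  The constant 6 suffices for \<open>n \<ge> 5\<close>; for smaller \<open>n\<close> the
  trivial bound is already strong enough.\<close>

section \<open>Transition operators and the Markov property for bounded functions\<close>

definition (in markov_process) transition_op :: "real \<Rightarrow> (real ^ 'd \<Rightarrow> real) \<Rightarrow> real ^ 'd \<Rightarrow> real" where
  "transition_op t \<phi> z = (\<integral>\<omega>. \<phi> (X t \<omega>) \<partial>P z)"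

context markov_process
begin

lemma space_P: "space (P x) = space M"
  using sets_P by (rule sets_eq_imp_space_eq)

lemma measurable_P: "measurable (P x) N = measurable M N"
  using sets_P by (rule measurable_cong_sets) simp

lemma measurable_X_P [measurable]: "t \<ge> 0 \<Longrightarrow> X t \<in> measurable (P x) borel"
  using measurable_X by (simp add: measurable_P)

lemma integrable_bounded_P:
  fixes B :: real
  assumes "Z \<in> borel_measurable (P x)" "\<And>\<omega>. \<bar>Z \<omega>\<bar> \<le> B"
  shows "integrable (P x) Z"
proof -
  interpret prob_space "P x" by (rule prob_space_P)
  show ?thesis using assms by (intro integrable_const_bound[of _ B]) auto
qed

lemma abs_integral_P_le:
  fixes B :: real
  assumes "Z \<in> borel_measurable (P x)" "\<And>\<omega>. \<bar>Z \<omega>\<bar> \<le> B"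
  shows "\<bar>\<integral>\<omega>. Z \<omega> \<partial>P x\<bar> \<le> B"
proof -
  interpret prob_space "P x" by (rule prob_space_P)
  have "\<bar>\<integral>\<omega>. Z \<omega> \<partial>P x\<bar> \<le> (\<integral>\<omega>. \<bar>Z \<omega>\<bar> \<partial>P x)"
    by (rule integral_abs_bound)
  also have "\<dots> \<le> (\<integral>\<omega>. B \<partial>P x)"
    using integrable_bounded_P[OF assms] assms(2) by (intro integral_mono) auto
  finally show ?thesis by (simp add: prob_space)
qed

text \<open>The locale gives measurability in the starting point for probabilities of sets only.
  Packaged as a measurable map into \<open>subprob_algebra borel\<close>, the kernel makes the
  integral of any measurable function measurable in the starting point.\<close>

lemma measurable_transition_op [measurable]:
  assumes [measurable]: "\<phi> \<in> borel_measurable borel" and t: "t \<ge> 0"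
  shows "transition_op t \<phi> \<in> borel_measurable borel"
proof -
  have kernel: "(\<lambda>z. distr (P z) borel (X t)) \<in> measurable borel (subprob_algebra borel)"
  proof (rule measurable_subprob_algebra)
    fix z
    interpret prob_space "P z" by (rule prob_space_P)
    show "subprob_space (distr (P z) borel (X t))"
      using t by (intro prob_space_imp_subprob_space prob_space_distr) measurable
  next
    fix A :: "(real ^ 'd) set" assume A: "A \<in> sets borel"
    have "emeasure (distr (P z) borel (X t)) A = ennreal (measure (P z) (X t -` A \<inter> space M))" for z
    proof -
      interpret prob_space "P z" by (rule prob_space_P)
      show ?thesis using A t by (simp add: emeasure_distr space_P emeasure_eq_measure)
    qed
    then show "(\<lambda>z. emeasure (distr (P z) borel (X t)) A) \<in> borel_measurable borel"
      using measurable_kernel[OF t A] by simp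
  qed simp
  have "(\<lambda>z. integral\<^sup>L (distr (P z) borel (X t)) \<phi>) \<in> borel_measurable borel"
    by (rule measurable_compose[OF kernel]) simp
  moreover have "integral\<^sup>L (distr (P z) borel (X t)) \<phi> = transition_op t \<phi> z" for z
    using t by (simp add: integral_distr transition_op_def)
  ultimately show ?thesis by simp
qed

lemma transition_op_bound:
  assumes "\<phi> \<in> borel_measurable borel" "\<And>y. \<bar>\<phi> y\<bar> \<le> B" "t \<ge> 0"
  shows "\<bar>transition_op t \<phi> z\<bar> \<le> B"
  unfolding transition_op_def using assms by (intro abs_integral_P_le) auto

lemma transition_op_diff:
  assumes [measurable]: "\<phi> \<in> borel_measurable borel" "\<psi> \<in> borel_measurable borel"
    and "\<And>y. \<bar>\<phi> y\<bar> \<le> B" "\<And>y. \<bar>\<psi> y\<bar> \<le> D" "t \<ge> 0"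
  shows "transition_op t (\<lambda>y. \<phi> y - \<psi> y) z = transition_op t \<phi> z - transition_op t \<psi> z"
  unfolding transition_op_def using assms
  by (intro Bochner_Integration.integral_diff integrable_bounded_P) auto

lemma subalgebra_past: "subalgebra (P x) (past M X s)"
  unfolding subalgebra_def
proof
  have *: "{X u -` A \<inter> space M | u A. 0 \<le> u \<and> u \<le> s \<and> A \<in> sets borel} \<subseteq> sets M"
    using measurable_X by (auto intro: measurable_sets)
  then have "{X u -` A \<inter> space M | u A. 0 \<le> u \<and> u \<le> s \<and> A \<in> sets borel} \<subseteq> Pow (space M)"
    by auto
  then show "space (past M X s) = space (P x)"
    unfolding past_def space_P by (rule space_measure_of)
  show "sets (past M X s) \<subseteq> sets (P x)"
    unfolding past_def sets_P using sets.sigma_sets_subset[OF *]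
    by (auto simp: sets_measure_of_conv)
qed

lemma measurable_past_P: "Z \<in> measurable (past M X s) N \<Longrightarrow> Z \<in> measurable (P x) N"
  by (rule measurable_from_subalg[OF subalgebra_past])

lemma space_past: "space (past M X s) = space M"
  using subalgebra_past by (simp add: subalgebra_def space_P)

lemma measurable_X_past:
  assumes "0 \<le> u" "u \<le> s"
  shows "X u \<in> borel_measurable (past M X s)"
proof (rule measurableI)
  fix A :: "(real ^ 'd) set" assume "A \<in> sets borel"
  then have "X u -` A \<inter> space M \<in> {X u -` A \<inter> space M | u A. 0 \<le> u \<and> u \<le> s \<and> A \<in> sets borel}"
    using assms by auto
  then show "X u -` A \<inter> space (past M X s) \<in> sets (past M X s)"
    unfolding space_past by (auto simp: past_def sets_measure_of_conv)
qed simp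

lemma measurable_past_mono:
  assumes "Z \<in> measurable (past M X s) N" "s \<le> t"
  shows "Z \<in> measurable (past M X t) N"
proof (rule measurable_from_subalg[OF _ assms(1)])
  have "{X u -` A \<inter> space M | u A. 0 \<le> u \<and> u \<le> s \<and> A \<in> sets borel}
      \<subseteq> {X u -` A \<inter> space M | u A. 0 \<le> u \<and> u \<le> t \<and> A \<in> sets borel}"
    using assms(2) by fastforce
  then have "sets (past M X s) \<subseteq> sets (past M X t)"
    unfolding past_def by (subst (1 2) sets_measure_of; (rule sigma_sets_mono')?) auto
  then show "subalgebra (past M X t) (past M X s)"
    by (simp add: subalgebra_def space_past)
qed

text \<open>Monotone class induction on \<phi>: the Markov axiom settles indicators, linearity
  extends this to scalings and sums, and dominated convergence, with bounds \<open>B\<close> and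
  \<open>a * B\<close>, handles increasing limits.\<close>

lemma markov_integral_nonneg:
  assumes Z: "Z \<in> borel_measurable (past M X s)" "\<And>\<omega>. \<bar>Z \<omega>\<bar> \<le> a"
    and \<phi>: "\<phi> \<in> borel_measurable borel" "\<And>y. 0 \<le> \<phi> y" "\<And>y. \<phi> y \<le> B"
    and s: "s \<ge> 0" and t: "t \<ge> 0"
  shows "(\<integral>\<omega>. Z \<omega> * \<phi> (X (s + t) \<omega>) \<partial>P x) = (\<integral>\<omega>. Z \<omega> * transition_op t \<phi> (X s \<omega>) \<partial>P x)"
proof -
  have ZP [measurable]: "Z \<in> borel_measurable (P x)"
    using Z(1) by (rule measurable_past_P)
  have a: "0 \<le> a" using Z(2)[of undefined] by linarith
  have int: "integrable (P x) (\<lambda>\<omega>. Z \<omega> * u (X r \<omega>))"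
    if [measurable]: "u \<in> borel_measurable borel" and "\<And>y. \<bar>u y\<bar> \<le> D" and "r \<ge> 0" for u D r
    using that Z(2) a by (intro integrable_bounded_P[of _ _ "a * D"]) (auto simp: abs_mult intro!: mult_mono)
  show ?thesis
    using \<phi>
  proof (induction arbitrary: B rule: borel_measurable_induct_real)
    case (set A)
    interpret finite_measure_subalgebra "P x" "past M X s"
      using prob_space_P subalgebra_past
      by (simp add: finite_measure_subalgebra_def finite_measure_subalgebra_axioms_def prob_space_def)
    have [measurable]: "A \<in> sets borel" using set by simp
    \<comment> \<open>\<open>Z\<close> is measurable for the past up to \<open>s\<close>, so inside
      the integral the indicator may be replaced by its conditional expectation, to which the Markov
      axiom applies.\<close>
    have "(\<integral>\<omega>. Z \<omega> * indicator A (X (s + t) \<omega>) \<partial>P x)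
        = (\<integral>\<omega>. Z \<omega> * real_cond_exp (P x) (past M X s) (\<lambda>\<omega>'. indicator A (X (s + t) \<omega>')) \<omega> \<partial>P x)"
      using s t by (intro real_cond_exp_intg(2)[symmetric] int[of _ 1] Z(1)) (auto simp: indicator_def)
    also have "\<dots> = (\<integral>\<omega>. Z \<omega> * measure (P (X s \<omega>)) (X t -` A \<inter> space M) \<partial>P x)"
      using markov[OF s t \<open>A \<in> sets borel\<close>, of x] s measurable_kernel[OF t \<open>A \<in> sets borel\<close>]
        measurable_from_subalg[OF subalg borel_measurable_cond_exp]
      by (intro integral_cong_AE) (auto intro!: borel_measurable_times intro: measurable_compose[OF measurable_X_P])
    also have "\<dots> = (\<integral>\<omega>. Z \<omega> * transition_op t (indicator A) (X s \<omega>) \<partial>P x)"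
    proof -
      have "measure (P z) (X t -` A \<inter> space M) = transition_op t (indicator A) z" for z
      proof -
      have "transition_op t (indicator A) z = (\<integral>\<omega>. indicator (X t -` A \<inter> space M) \<omega> \<partial>P z)"
        unfolding transition_op_def
        by (intro Bochner_Integration.integral_cong) (auto simp: indicator_def space_P)
        then show ?thesis by (simp add: space_P)
      qed
      then show ?thesis by simp
    qed
    finally show ?case .
  next
    case (mult u c)
    note [measurable] = mult.hyps(2)
    show ?case
    \<comment> \<open>For \<open>c = 0\<close> the bound on the product says nothing about
      \<open>u\<close>, but both sides vanish. Otherwise \<open>u\<close> is bounded by
      \<open>B / c\<close>; this change of bound is why the induction generalizes
      \<open>B\<close>.\<close>
    proof (cases "c = 0")
      case False
      have "\<And>y. u y \<le> B / c"
        using mult.hyps(1) mult.prems False by (simp add: field_simps)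
      from mult.IH[OF this] show ?thesis
        by (simp add: transition_op_def mult.left_commute[of _ c])
    qed (simp add: transition_op_def)
  next
    case (add u v)
    note [measurable] = add.hyps(1,3)
    have bu: "u y \<le> B" and bv: "v y \<le> B" for y
      using add.hyps(2,4)[of y] add.prems[of y] by linarith+
    have abs: "\<And>y. \<bar>u y\<bar> \<le> B" "\<And>y. \<bar>v y\<bar> \<le> B"
      using bu bv add.hyps(2,4) by auto
    have "transition_op t (\<lambda>y. v y + u y) z = transition_op t v z + transition_op t u z" for z
      unfolding transition_op_def using abs t
      by (intro Bochner_Integration.integral_add integrable_bounded_P) auto
    then show ?case
      using add.IH(1)[OF bu] add.IH(2)[OF bv] s t abs
      by (simp add: distrib_left int[where D=B] transition_op_bound)
  next
    case (seq U)
    note [measurable] = seq.hyps(1) \<phi>(1)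
    have UB: "U i y \<le> B" for i y
    proof -
      have "U i y \<le> \<phi> y" by (rule incseq_le) (use seq.hyps(3,4) in \<open>auto simp: incseq_def le_fun_def\<close>)
      then show ?thesis using seq.prems[of y] by simp
    qed
    have U_abs: "\<bar>U i y\<bar> \<le> B" and \<phi>_abs: "\<bar>\<phi> y\<bar> \<le> B" for i y
      using UB[of i y] seq.hyps(2) seq.prems \<phi>(2) by (simp_all add: abs_of_nonneg)
    have op_lim: "(\<lambda>i. transition_op t (U i) z) \<longlonglongrightarrow> transition_op t \<phi> z" for z
    proof -
      interpret prob_space "P z" by (rule prob_space_P)
      show ?thesis unfolding transition_op_def
        using t seq.hyps(4) U_abs by (intro integral_dominated_convergence[where w="\<lambda>_. B"]) auto
    qed
    interpret prob_space "P x" by (rule prob_space_P)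
    have "(\<lambda>i. \<integral>\<omega>. Z \<omega> * U i (X (s + t) \<omega>) \<partial>P x) \<longlonglongrightarrow> (\<integral>\<omega>. Z \<omega> * \<phi> (X (s + t) \<omega>) \<partial>P x)"
      using s t seq.hyps(4) U_abs Z(2) a
      by (intro integral_dominated_convergence[where w="\<lambda>_. a * B"])
         (auto simp: abs_mult intro!: tendsto_mult_left mult_mono)
    moreover have "(\<lambda>i. \<integral>\<omega>. Z \<omega> * transition_op t (U i) (X s \<omega>) \<partial>P x)
        \<longlonglongrightarrow> (\<integral>\<omega>. Z \<omega> * transition_op t \<phi> (X s \<omega>) \<partial>P x)"
      using s t op_lim transition_op_bound[OF seq.hyps(1) U_abs t] Z(2) a
      by (intro integral_dominated_convergence[where w="\<lambda>_. a * B"])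
         (auto simp: abs_mult intro!: tendsto_mult_left mult_mono)
    ultimately show ?case
      unfolding seq.IH[OF UB] by (rule LIMSEQ_unique)
  qed
qed

text \<open>Positive and negative parts of \<phi> inherit the bound \<open>B\<close>, so the
  nonnegative case applies to each.\<close>

lemma markov_integral:
  assumes Z: "Z \<in> borel_measurable (past M X s)" "\<And>\<omega>. \<bar>Z \<omega>\<bar> \<le> a"
    and \<phi> [measurable]: "\<phi> \<in> borel_measurable borel" and B: "\<And>y. \<bar>\<phi> y\<bar> \<le> B"
    and s: "s \<ge> 0" and t: "t \<ge> 0"
  shows "(\<integral>\<omega>. Z \<omega> * \<phi> (X (s + t) \<omega>) \<partial>P x) = (\<integral>\<omega>. Z \<omega> * transition_op t \<phi> (X s \<omega>) \<partial>P x)"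
proof -
  have ZP [measurable]: "Z \<in> borel_measurable (P x)"
    using Z(1) by (rule measurable_past_P)
  have a: "0 \<le> a" using Z(2)[of undefined] by linarith
  have int: "integrable (P x) (\<lambda>\<omega>. Z \<omega> * u (X r \<omega>))"
    if [measurable]: "u \<in> borel_measurable borel" and "\<And>y. \<bar>u y\<bar> \<le> D" and "r \<ge> 0" for u D r
    using that Z(2) a by (intro integrable_bounded_P[of _ _ "a * D"]) (auto simp: abs_mult intro!: mult_mono)
  define \<psi>1 \<psi>2 where "\<psi>1 y = max 0 (\<phi> y)" and "\<psi>2 y = max 0 (- \<phi> y)" for y
  have [measurable]: "\<psi>1 \<in> borel_measurable borel" "\<psi>2 \<in> borel_measurable borel"
    by (simp_all add: \<psi>1_def[abs_def] \<psi>2_def[abs_def])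
  have nonneg: "0 \<le> \<psi>1 y" "0 \<le> \<psi>2 y" and le: "\<psi>1 y \<le> B" "\<psi>2 y \<le> B" for y
    using B[of y] by (auto simp: \<psi>1_def \<psi>2_def)
  have abs: "\<bar>\<psi>1 y\<bar> \<le> B" "\<bar>\<psi>2 y\<bar> \<le> B" for y
    using nonneg[of y] le[of y] by simp_all
  have \<phi>_eq: "\<phi> = (\<lambda>y. \<psi>1 y - \<psi>2 y)"
    by (auto simp: \<psi>1_def \<psi>2_def max_def)
  have op: "transition_op t \<phi> z = transition_op t \<psi>1 z - transition_op t \<psi>2 z" for z
    unfolding \<phi>_eq using abs t by (intro transition_op_diff) auto
  show ?thesis
    unfolding op unfolding \<phi>_eq right_diff_distrib
    using s t abs markov_integral_nonneg[where \<phi>=\<psi>1, OF Z _ nonneg(1) le(1) s t]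
      markov_integral_nonneg[where \<phi>=\<psi>2, OF Z _ nonneg(2) le(2) s t]
    by (simp add: int[where D=B] transition_op_bound)
qed

text \<open>Everything after time \<open>s\<close> is condensed into a single function of the state
  at \<open>s\<close>, built backwards in time: peel off the earliest index, multiply its factor by
  the function obtained for the rest, and apply a transition operator. One \<open>g\<close> serves
  all \<open>x\<close> and \<open>Z\<close>; both the induction and the later comparison of two
  products with the same future rely on this.\<close>

lemma markov_integral_prod:
  fixes \<phi> :: "'i \<Rightarrow> real ^ 'd \<Rightarrow> real"
  assumes "finite J" "\<And>j. j \<in> J \<Longrightarrow> s \<le> t j" "s \<ge> 0"
    and "\<And>j. j \<in> J \<Longrightarrow> \<phi> j \<in> borel_measurable borel" "\<And>j y. j \<in> J \<Longrightarrow> \<bar>\<phi> j y\<bar> \<le> b j"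
  shows "\<exists>g \<in> borel_measurable borel. (\<forall>y. \<bar>g y\<bar> \<le> (\<Prod>j\<in>J. b j)) \<and>
    (\<forall>x Z a. Z \<in> borel_measurable (past M X s) \<longrightarrow> (\<forall>\<omega>. \<bar>Z \<omega>\<bar> \<le> a) \<longrightarrow>
      (\<integral>\<omega>. Z \<omega> * (\<Prod>j\<in>J. \<phi> j (X (t j) \<omega>)) \<partial>P x) = (\<integral>\<omega>. Z \<omega> * g (X s \<omega>) \<partial>P x))"
  using assms
proof (induction "card J" arbitrary: J s)
  case 0
  then show ?case by (intro bexI[of _ "\<lambda>_. 1"]) auto
next
  case (Suc m)
  obtain j where j: "j \<in> J" and j_min: "\<And>i. i \<in> J \<Longrightarrow> t j \<le> t i"
    using Suc.hyps(2) Suc.prems(1) arg_min_if_finite(1)[of J t] arg_min_least[of J _ t]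
    by (metis card.empty nat.distinct(1))
  have tj: "s \<le> t j" "0 \<le> t j" using Suc.prems j by force+
  have [measurable]: "\<phi> j \<in> borel_measurable borel" using Suc.prems j by blast
  let ?J = "J - {j}"
  have "m = card ?J" using Suc.hyps(2) Suc.prems(1) j by simp
  from Suc.hyps(1)[OF this, of "t j"] obtain g where g [measurable]: "g \<in> borel_measurable borel"
    and g_le: "\<And>y. \<bar>g y\<bar> \<le> (\<Prod>j\<in>?J. b j)"
    and g_int: "\<And>x Z a. Z \<in> borel_measurable (past M X (t j)) \<Longrightarrow> (\<And>\<omega>. \<bar>Z \<omega>\<bar> \<le> a) \<Longrightarrow>
      (\<integral>\<omega>. Z \<omega> * (\<Prod>j\<in>?J. \<phi> j (X (t j) \<omega>)) \<partial>P x) = (\<integral>\<omega>. Z \<omega> * g (X (t j) \<omega>) \<partial>P x)"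
    using Suc.prems tj j_min by (auto simp: Ball_def) blast
  have prod: "(\<Prod>j\<in>J. w j) = w j * (\<Prod>j\<in>?J. w j)" for w :: "_ \<Rightarrow> real"
    using Suc.prems(1) j by (rule prod.remove)
  let ?\<psi> = "\<lambda>y. \<phi> j y * g y"
  have \<psi>_le: "\<bar>?\<psi> y\<bar> \<le> (\<Prod>j\<in>J. b j)" for y
    unfolding prod abs_mult using Suc.prems(5)[OF j, of y] g_le[of y] by (intro mult_mono) auto
  show ?case
  proof (intro bexI[of _ "transition_op (t j - s) ?\<psi>"] conjI allI impI)
    show "\<bar>transition_op (t j - s) ?\<psi> y\<bar> \<le> (\<Prod>j\<in>J. b j)" for y
      using \<psi>_le tj by (intro transition_op_bound) auto
    show "transition_op (t j - s) ?\<psi> \<in> borel_measurable borel" using tj by (intro measurable_transition_op) auto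
    fix x Z and a :: real assume Z: "Z \<in> borel_measurable (past M X s)" and "\<forall>\<omega>. \<bar>Z \<omega>\<bar> \<le> a"
    then have a: "\<And>\<omega>. \<bar>Z \<omega>\<bar> \<le> a" by blast
    \<comment> \<open>The earliest factor belongs to the past at its own time \<open>t j\<close>, so
      it can join \<open>Z\<close> when the induction hypothesis is applied there.\<close>
    have "(\<lambda>\<omega>. Z \<omega> * \<phi> j (X (t j) \<omega>)) \<in> borel_measurable (past M X (t j))"
      using tj measurable_past_mono[OF Z] measurable_X_past[of "t j" "t j"]
      by (intro borel_measurable_times measurable_compose[of "X (t j)" _ borel "\<phi> j"]) auto
    moreover have "\<bar>Z \<omega> * \<phi> j (X (t j) \<omega>)\<bar> \<le> a * b j" for \<omega>
      unfolding abs_mult using a[of \<omega>] Suc.prems(5)[OF j] by (intro mult_mono) auto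
    ultimately have "(\<integral>\<omega>. Z \<omega> * (\<Prod>j\<in>J. \<phi> j (X (t j) \<omega>)) \<partial>P x) = (\<integral>\<omega>. Z \<omega> * ?\<psi> (X (s + (t j - s)) \<omega>) \<partial>P x)"
      unfolding prod using g_int[of "\<lambda>\<omega>. Z \<omega> * \<phi> j (X (t j) \<omega>)" "a * b j" x] by (simp add: mult.assoc)
    also have "\<dots> = (\<integral>\<omega>. Z \<omega> * transition_op (t j - s) ?\<psi> (X s \<omega>) \<partial>P x)"
      using Z a \<psi>_le tj Suc.prems(3) by (intro markov_integral) auto
    finally show "(\<integral>\<omega>. Z \<omega> * (\<Prod>j\<in>J. \<phi> j (X (t j) \<omega>)) \<partial>P x)
      = (\<integral>\<omega>. Z \<omega> * transition_op (t j - s) ?\<psi> (X s \<omega>) \<partial>P x)" .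
  qed
qed

end

section \<open>Regularity of the transition operators in time\<close>

text \<open>The derivative exists everywhere but may be discontinuous, so the fundamental theorem is
  applied with the gauge integral, and domination by \<open>g\<close> leads back to a Lebesgue
  integral. The bound lives in \<open>ennreal\<close> because for a single point of the state space
  the time integral of the majorant may be infinite.\<close>

lemma differentiable_increment_nn_integral_bound:
  fixes f g :: "real \<Rightarrow> real"
  assumes "u \<le> v"
    and diff: "\<And>w. w \<in> {u..v} \<Longrightarrow> f differentiable (at w)"
    and bound: "\<And>w. w \<in> {u..v} \<Longrightarrow> \<bar>deriv f w\<bar> \<le> g w"
    and [measurable]: "g \<in> borel_measurable borel"
  shows "ennreal \<bar>f v - f u\<bar> \<le> (\<integral>\<^sup>+w. ennreal (g w) * indicator {u..v} w \<partial>lborel)"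
proof (cases "(\<integral>\<^sup>+w. ennreal (g w) * indicator {u..v} w \<partial>lborel) = \<infinity>")
  case False
  have g_nonneg: "0 \<le> g w" if "w \<in> {u..v}" for w
    using bound[OF that] by linarith
  have eq: "(\<integral>\<^sup>+w. ennreal (g w) * indicator {u..v} w \<partial>lborel)
      = (\<integral>\<^sup>+w. ennreal (indicator {u..v} w *\<^sub>R g w) \<partial>lborel)"
    by (intro nn_integral_cong) (simp add: indicator_def)
  have g_int: "set_integrable lborel {u..v} g"
    unfolding set_integrable_def
    using False g_nonneg unfolding eq by (intro integrableI_nonneg) (auto simp: indicator_def less_top)
  have "(deriv f has_integral (f v - f u)) {u..v}"
  proof (rule fundamental_theorem_of_calculus)
    fix w assume "w \<in> {u..v}"
    then have "(f has_real_derivative deriv f w) (at w)"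
      using diff by (simp add: DERIV_deriv_iff_real_differentiable)
    then show "(f has_vector_derivative deriv f w) (at w within {u..v})"
      by (metis has_real_derivative_iff_has_vector_derivative has_vector_derivative_at_within)
  qed fact
  then have "\<bar>f v - f u\<bar> \<le> integral {u..v} g"
    using integral_norm_bound_integral[of "deriv f" "{u..v}" g] bound set_borel_integral_eq_integral(1)[OF g_int]
    by (auto simp: has_integral_iff)
  also have "integral {u..v} g = (\<integral>w. indicator {u..v} w *\<^sub>R g w \<partial>lborel)"
    using set_borel_integral_eq_integral(2)[OF g_int] by (simp add: set_lebesgue_integral_def)
  finally have "ennreal \<bar>f v - f u\<bar> \<le> ennreal (\<integral>w. indicator {u..v} w *\<^sub>R g w \<partial>lborel)"
    by (rule ennreal_leI)
  also have "\<dots> = (\<integral>\<^sup>+w. ennreal (indicator {u..v} w *\<^sub>R g w) \<partial>lborel)"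
    using g_int g_nonneg unfolding set_integrable_def
    by (intro nn_integral_eq_integral[symmetric]) (auto simp: indicator_def)
  finally show ?thesis unfolding eq .
qed simp

context markov_process
begin

text \<open>The difference is at most \<open>B\<close> times the L1 distance of the densities at
  times \<open>u\<close> and \<open>v\<close>. Integrate the derivative bound over time, exchange
  the two integrals, and use that \<open>q\<close> has mass 1 in \<open>y\<close> and that
  \<open>1 / w\<close> is at most \<open>1 / u\<close> on the interval from \<open>u\<close> to
  \<open>v\<close>.\<close>

lemma transition_op_time_regularity:
  assumes cX: "condition_X P X p C"
    and \<phi> [measurable]: "\<phi> \<in> borel_measurable borel" and B: "\<And>y. \<bar>\<phi> y\<bar> \<le> B"
    and uv: "0 < u" "u \<le> v" "v \<le> T"
  shows "\<bar>transition_op v \<phi> z - transition_op u \<phi> z\<bar> \<le> C T * (v - u) / u * B"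
proof -
  from cX[unfolded condition_X_def, THEN conjunct2, THEN conjunct2]
  obtain q where q_meas: "(\<lambda>(t, x, y). q t x y)
        \<in> borel_measurable (restrict_space borel {0<..} \<Otimes>\<^sub>M borel \<Otimes>\<^sub>M borel)"
    and q_dens: "\<forall>t>0. \<forall>x. distribution_density (q t x)"
    and q_bound: "\<forall>T>0. C T \<ge> 1 \<and> (\<forall>t x y. 0 < t \<and> t \<le> T \<longrightarrow>
        \<bar>deriv (\<lambda>s. p s x y) t\<bar> \<le> C T * (1 / t) * q t x y)"
    by (elim exE conjE)
  have "T > 0" using uv by linarith
  from q_bound[rule_format, OF this] have CT: "C T \<ge> 1"
    and p_deriv: "0 < t \<Longrightarrow> t \<le> T \<Longrightarrow> \<bar>deriv (\<lambda>s. p s x y) t\<bar> \<le> C T * (1 / t) * q t x y" for t x y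
    by simp_all
  have p_nonneg: "0 \<le> p t z y" and p_distr: "distributed (P z) lborel (X t) (\<lambda>y. ennreal (p t z y))"
    if "t > 0" for t y
    using cX that by (simp_all add: condition_X_def transition_density_def)
  have p_diff: "(\<lambda>s. p s z y) differentiable (at t)" if "t > 0" for t y
    using cX that by (simp add: condition_X_def)
  have v: "0 < v" and B0: "0 \<le> B" using uv B[of undefined] by linarith+
  have p_int: "integrable lborel (p t z)" "(\<lambda>y. p t z y) \<in> borel_measurable lborel" if "t > 0" for t
  proof -
    show m: "(\<lambda>y. p t z y) \<in> borel_measurable lborel"
      using distributed_real_measurable[OF _ p_distr[OF that]] p_nonneg[OF that] by simp
    interpret prob_space "P z" by (rule prob_space_P)
    have "(\<integral>\<^sup>+y. ennreal (p t z y) \<partial>lborel) = 1"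
      using distributed_nn_integral[OF p_distr[OF that], of "\<lambda>_. 1"] emeasure_space_1 by simp
    then show "integrable lborel (p t z)"
      using m p_nonneg[OF that] by (intro integrableI_nonneg) auto
  qed
  have op: "transition_op t \<phi> z = (\<integral>y. p t z y * \<phi> y \<partial>lborel)" if "t > 0" for t
    unfolding transition_op_def
    using p_nonneg[OF that] by (intro distributed_integral[OF p_distr[OF that], symmetric]) auto
  have pint': "integrable lborel (\<lambda>y. p t z y * \<phi> y)" if "t > 0" for t
    using p_int[OF that] B B0
    by (intro Bochner_Integration.integrable_bound[OF integrable_mult_right[of B, OF p_int(1)[OF that]]])
       (auto simp: abs_mult mult.commute intro!: mult_right_mono)
  \<comment> \<open>The argument \<open>max u w\<close> stays positive for every real
    \<open>w\<close> and equals \<open>w\<close> on the interval of integration; this gives a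
    majorant jointly measurable on the whole line.\<close>
  let ?q = "\<lambda>w y. C T / u * q (max u w) z y"
  have [measurable]: "(\<lambda>(w, y). q (max u w) z y) \<in> borel_measurable (borel \<Otimes>\<^sub>M borel)"
  proof -
    have "(\<lambda>(w, y). (max u w, z, y)) \<in> measurable (borel \<Otimes>\<^sub>M borel)
        (restrict_space borel {0<..} \<Otimes>\<^sub>M borel \<Otimes>\<^sub>M borel)"
      using uv by (auto intro!: measurable_Pair measurable_restrict_space2 simp: split_beta' less_max_iff_disj)
    from measurable_compose[OF this q_meas] show ?thesis by (simp add: split_beta')
  qed
  have q_nonneg: "0 \<le> q (max u w) z y" for w y
    using q_dens[rule_format, of "max u w" z] uv by (auto simp: distribution_density_def less_max_iff_disj)
  have incr: "ennreal \<bar>p v z y - p u z y\<bar> \<le> (\<integral>\<^sup>+w. ennreal (?q w y) * indicator {u..v} w \<partial>lborel)" for y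
  proof (rule differentiable_increment_nn_integral_bound)
    fix w assume w: "w \<in> {u..v}"
    have "\<bar>deriv (\<lambda>s. p s z y) w\<bar> \<le> C T * (1 / w) * q w z y"
      using w uv by (intro p_deriv) auto
    also have "\<dots> \<le> C T * (1 / u) * q w z y"
      using w uv CT q_nonneg[of w y] by (intro mult_right_mono mult_left_mono divide_left_mono) (auto simp: max_def)
    finally show "\<bar>deriv (\<lambda>s. p s z y) w\<bar> \<le> ?q w y" using w by (simp add: max_def)
  qed (use uv in \<open>auto intro: p_diff\<close>)
  have "(\<integral>\<^sup>+y. ennreal \<bar>p v z y - p u z y\<bar> \<partial>lborel)
      \<le> (\<integral>\<^sup>+y. (\<integral>\<^sup>+w. ennreal (?q w y) * indicator {u..v} w \<partial>lborel) \<partial>lborel)"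
    by (intro nn_integral_mono incr)
  also have "\<dots> = (\<integral>\<^sup>+w. (\<integral>\<^sup>+y. ennreal (?q w y) * indicator {u..v} w \<partial>lborel) \<partial>lborel)"
    by (rule lborel_pair.Fubini') measurable
  also have "\<dots> = (\<integral>\<^sup>+w. ennreal (C T / u) * indicator {u..v} w \<partial>lborel)"
  proof (intro nn_integral_cong)
    fix w
    have "max u w > 0" using uv by simp
    from q_dens[rule_format, OF this, of z] have [measurable]: "q (max u w) z \<in> borel_measurable borel"
      and "(\<integral>\<^sup>+y. ennreal (q (max u w) z y) \<partial>lborel) = 1"
      by (auto simp: distribution_density_def)
    then show "(\<integral>\<^sup>+y. ennreal (?q w y) * indicator {u..v} w \<partial>lborel) = ennreal (C T / u) * indicator {u..v} w"
      using CT uv q_nonneg by (simp add: ennreal_mult' nn_integral_cmult nn_integral_multc del: times_divide_eq_left)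
  qed
  also have "\<dots> = ennreal (C T / u * (v - u))"
    using uv CT by (simp add: nn_integral_cmult ennreal_mult del: times_divide_eq_left)
  finally have tv: "(\<integral>\<^sup>+y. ennreal \<bar>p v z y - p u z y\<bar> \<partial>lborel) \<le> ennreal (C T / u * (v - u))" .
  have tv_int: "integrable lborel (\<lambda>y. \<bar>p v z y - p u z y\<bar>)"
    using p_int(1) uv v by auto
  have tv': "(\<integral>y. \<bar>p v z y - p u z y\<bar> \<partial>lborel) \<le> C T / u * (v - u)"
    using tv CT uv by (simp add: nn_integral_eq_integral[OF tv_int] ennreal_le_iff)
  have "transition_op v \<phi> z - transition_op u \<phi> z = (\<integral>y. (p v z y - p u z y) * \<phi> y \<partial>lborel)"
    using uv v pint' by (simp add: op left_diff_distrib)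
  also have "\<bar>\<dots>\<bar> \<le> (\<integral>y. \<bar>(p v z y - p u z y) * \<phi> y\<bar> \<partial>lborel)"
    by (rule integral_abs_bound)
  also have "\<dots> \<le> (\<integral>y. \<bar>p v z y - p u z y\<bar> * B \<partial>lborel)"
  proof (rule integral_mono)
    show "integrable lborel (\<lambda>y. \<bar>(p v z y - p u z y) * \<phi> y\<bar>)"
      using uv v pint' by (intro integrable_abs) (simp add: left_diff_distrib)
  qed (use tv_int B in \<open>auto simp: abs_mult intro!: mult_left_mono\<close>)
  also have "\<dots> \<le> C T / u * (v - u) * B"
    using mult_right_mono[OF tv' B0] by simp
  finally show ?thesis by simp
qed

section \<open>Moving one sample time, then all of them\<close>

text \<open>Moving the intermediate point from \<open>s\<close> to \<open>t\<close> shifts the law of the past increment as well as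
  the increment to the next evaluation point; the two shifts are handled separately.\<close>

lemma three_point_increment:
  assumes A: "A \<in> borel_measurable (past M X r)" "\<And>\<omega>. \<bar>A \<omega>\<bar> \<le> a"
    and h [measurable]: "h \<in> borel_measurable borel" and H: "\<And>y. \<bar>h y\<bar> \<le> H"
    and g [measurable]: "g \<in> borel_measurable borel" and G: "\<And>y. \<bar>g y\<bar> \<le> G"
    and times: "0 \<le> r" "r \<le> s" "s \<le> t" "t \<le> \<tau>"
    and past_increment: "\<And>\<phi> B z. \<phi> \<in> borel_measurable borel \<Longrightarrow> (\<And>y. \<bar>\<phi> y\<bar> \<le> B) \<Longrightarrow>
      \<bar>transition_op (t - r) \<phi> z - transition_op (s - r) \<phi> z\<bar> \<le> e1 * B"
    and future_increment: "\<And>\<phi> B z. \<phi> \<in> borel_measurable borel \<Longrightarrow> (\<And>y. \<bar>\<phi> y\<bar> \<le> B) \<Longrightarrow>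
      \<bar>transition_op (\<tau> - s) \<phi> z - transition_op (\<tau> - t) \<phi> z\<bar> \<le> e2 * B"
  shows "\<bar>(\<integral>\<omega>. A \<omega> * (h (X t \<omega>) * g (X \<tau> \<omega>)) \<partial>P x) - (\<integral>\<omega>. A \<omega> * (h (X s \<omega>) * g (X \<tau> \<omega>)) \<partial>P x)\<bar>
      \<le> a * (H * G) * (e1 + e2)"
proof -
  have H0: "0 \<le> H" and G0: "0 \<le> G" and a0: "0 \<le> a"
    using H[of undefined] G[of undefined] A(2)[of undefined] by linarith+
  \<comment> \<open>Given the state \<open>y\<close> at time \<open>u\<close>, \<psi> is the
    conditional expectation of the present factor times the future one.\<close>
  define \<psi> where "\<psi> u y = h y * transition_op (\<tau> - u) g y" for u y
  have \<psi>_meas [measurable]: "\<psi> u \<in> borel_measurable borel" if "u \<le> \<tau>" for u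
    using that by (simp add: \<psi>_def[abs_def])
  have \<psi>_bound: "\<bar>\<psi> u y\<bar> \<le> H * G" if "u \<le> \<tau>" for u y
    unfolding \<psi>_def abs_mult using that H G H0 by (intro mult_mono transition_op_bound) auto
  \<comment> \<open>The Markov property is used twice: at \<open>u\<close> to average out the
    future, then at \<open>r\<close> to average out the present.\<close>
  have reduce: "(\<integral>\<omega>. A \<omega> * (h (X u \<omega>) * g (X \<tau> \<omega>)) \<partial>P x)
      = (\<integral>\<omega>. A \<omega> * transition_op (u - r) (\<psi> u) (X r \<omega>) \<partial>P x)" if u: "r \<le> u" "u \<le> \<tau>" for u
  proof -
    have "(\<lambda>\<omega>. A \<omega> * h (X u \<omega>)) \<in> borel_measurable (past M X u)"
      using u times measurable_past_mono[OF A(1)] measurable_X_past[of u u]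
      by (intro borel_measurable_times measurable_compose[OF _ h]) auto
    moreover have "\<bar>A \<omega> * h (X u \<omega>)\<bar> \<le> a * H" for \<omega>
      unfolding abs_mult using A(2) H a0 by (intro mult_mono) auto
    ultimately have "(\<integral>\<omega>. A \<omega> * h (X u \<omega>) * g (X (u + (\<tau> - u)) \<omega>) \<partial>P x)
        = (\<integral>\<omega>. A \<omega> * h (X u \<omega>) * transition_op (\<tau> - u) g (X u \<omega>) \<partial>P x)"
      using u times G by (intro markov_integral) auto
    then have "(\<integral>\<omega>. A \<omega> * (h (X u \<omega>) * g (X \<tau> \<omega>)) \<partial>P x) = (\<integral>\<omega>. A \<omega> * \<psi> u (X (r + (u - r)) \<omega>) \<partial>P x)"
      by (simp add: \<psi>_def mult.assoc)
    also have "\<dots> = (\<integral>\<omega>. A \<omega> * transition_op (u - r) (\<psi> u) (X r \<omega>) \<partial>P x)"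
      using u times A \<psi>_bound by (intro markov_integral) auto
    finally show ?thesis .
  qed
  have A_meas [measurable]: "A \<in> borel_measurable (P x)" using A(1) by (rule measurable_past_P)
  have int: "integrable (P x) (\<lambda>\<omega>. A \<omega> * transition_op (u - r) (\<psi> u) (X r \<omega>))" if u: "r \<le> u" "u \<le> \<tau>" for u
    using u times A(2) a0 transition_op_bound[OF \<psi>_meas \<psi>_bound]
    by (intro integrable_bounded_P[of _ _ "a * (H * G)"]) (auto simp: abs_mult intro!: mult_mono)
  \<comment> \<open>Insert \<open>transition_op (t - r) (\<psi> s) z\<close>. One difference changes
    only the function and is controlled by the future increment, the other changes only the operator
    and is controlled by the past increment.\<close>
  have diff: "\<bar>transition_op (t - r) (\<psi> t) z - transition_op (s - r) (\<psi> s) z\<bar> \<le> H * G * (e1 + e2)" for z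
  proof -
    have "\<bar>\<psi> t y - \<psi> s y\<bar> \<le> H * (e2 * G)" for y
    proof -
      have "\<psi> t y - \<psi> s y = h y * (transition_op (\<tau> - t) g y - transition_op (\<tau> - s) g y)"
        by (simp add: \<psi>_def right_diff_distrib)
      then show ?thesis
        using H0 H[of y] future_increment[OF g G, of y] by (auto simp: abs_mult abs_minus_commute intro!: mult_mono)
    qed
    then have "\<bar>transition_op (t - r) (\<lambda>y. \<psi> t y - \<psi> s y) z\<bar> \<le> H * (e2 * G)"
      using times by (intro transition_op_bound) auto
    moreover have "transition_op (t - r) (\<lambda>y. \<psi> t y - \<psi> s y) z
        = transition_op (t - r) (\<psi> t) z - transition_op (t - r) (\<psi> s) z"
      using times \<psi>_bound by (intro transition_op_diff[where B="H * G" and D="H * G"]) auto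
    moreover have "\<bar>transition_op (t - r) (\<psi> s) z - transition_op (s - r) (\<psi> s) z\<bar> \<le> e1 * (H * G)"
      using times \<psi>_bound by (intro past_increment) auto
    moreover have "H * G * (e1 + e2) = H * (e2 * G) + e1 * (H * G)"
      by (simp add: algebra_simps)
    ultimately show ?thesis by linarith
  qed
  have "(\<integral>\<omega>. A \<omega> * (h (X t \<omega>) * g (X \<tau> \<omega>)) \<partial>P x) - (\<integral>\<omega>. A \<omega> * (h (X s \<omega>) * g (X \<tau> \<omega>)) \<partial>P x)
      = (\<integral>\<omega>. A \<omega> * (transition_op (t - r) (\<psi> t) (X r \<omega>) - transition_op (s - r) (\<psi> s) (X r \<omega>)) \<partial>P x)"
    using times int by (simp add: reduce right_diff_distrib)
  also have "\<bar>\<dots>\<bar> \<le> a * (H * G * (e1 + e2))"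
    using times A(2) diff a0 by (intro abs_integral_P_le) (auto simp: abs_mult intro!: mult_mono)
  finally show ?thesis by (simp add: mult.assoc)
qed

end

text \<open>\<open>lag_weight c m\<close> bounds the change of law over one grid cell after \<open>m\<close> full cells have elapsed; for
  \<open>m = 0\<close> only the trivial bound 2 is available.\<close>

definition lag_weight :: "real \<Rightarrow> nat \<Rightarrow> real" where
  "lag_weight c m = c * (if m = 0 then 2 else 1 / real m)"

text \<open>A point of cell \<open>a\<close> is moved to the left end of that cell.  An earlier point, already moved, sits at the
  left end of its cell \<open>b\<close>; a later point is anywhere in its cell \<open>b\<close>, which costs one more cell.\<close>

definition cell_weight :: "real \<Rightarrow> nat \<Rightarrow> nat \<Rightarrow> real" where
  "cell_weight c a b = lag_weight c (if b \<le> a then a - b else b - a - 1)"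

lemma lag_weight_nonneg: "0 \<le> c \<Longrightarrow> 0 \<le> lag_weight c m"
  by (simp add: lag_weight_def)

lemma cell_weight_nonneg: "0 \<le> c \<Longrightarrow> 0 \<le> cell_weight c a b"
  by (simp add: cell_weight_def lag_weight_nonneg)

lemma condition_X_const_ge_1: "condition_X P X p C \<Longrightarrow> T > 0 \<Longrightarrow> 1 \<le> C T"
  unfolding condition_X_def by (elim conjE exE) simp

context markov_process
begin

text \<open>For positive \<open>m\<close>, \<open>v - u\<close> is at most one cell and
  \<open>u\<close> at least \<open>m\<close> cells, so the ratio in the regularity estimate is at
  most \<open>1 / m\<close>. For \<open>m = 0\<close> the trivial bound \<open>2 * B\<close> fits
  under the weight because \<open>C T\<close> is at least 1.\<close>

lemma transition_op_cell_increment: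
  assumes cX: "condition_X P X p C" and T: "T > 0" and n: "n > 0"
    and \<phi>: "\<phi> \<in> borel_measurable borel" and B: "\<And>y. \<bar>\<phi> y\<bar> \<le> B"
    and uv: "0 \<le> u" "u \<le> v" "v \<le> T" "v - u \<le> T / real n" "real m * T / real n \<le> u"
  shows "\<bar>transition_op v \<phi> z - transition_op u \<phi> z\<bar> \<le> lag_weight (C T) m * B"
proof (cases "m = 0")
  case True
  have "\<bar>transition_op v \<phi> z\<bar> \<le> B" "\<bar>transition_op u \<phi> z\<bar> \<le> B"
    using uv by (auto intro!: transition_op_bound[OF \<phi> B])
  then have "\<bar>transition_op v \<phi> z - transition_op u \<phi> z\<bar> \<le> 2 * B" by linarith
  also have "\<dots> \<le> lag_weight (C T) m * B"
    using True condition_X_const_ge_1[OF cX T] B[of undefined]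
    by (intro mult_right_mono) (auto simp: lag_weight_def)
  finally show ?thesis .
next
  case False
  define \<delta> where "\<delta> = T / real n"
  have \<delta>: "0 < \<delta>" "real m * \<delta> \<le> u" "v - u \<le> \<delta>" using T n uv by (simp_all add: \<delta>_def)
  then have m: "0 < real m * \<delta>" using False by simp
  with \<delta> have u: "0 < u" by linarith
  have "(v - u) / u \<le> \<delta> / (real m * \<delta>)"
    using \<delta> m u uv by (intro frac_le) auto
  then have le: "(v - u) / u \<le> 1 / real m" using \<delta>(1) by simp
  have "\<bar>transition_op v \<phi> z - transition_op u \<phi> z\<bar> \<le> C T * (v - u) / u * B"
    using u uv by (intro transition_op_time_regularity[OF cX \<phi> B]) auto
  also have "\<dots> = C T * ((v - u) / u) * B" by simp
  also have "\<dots> \<le> C T * (1 / real m) * B"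
    using condition_X_const_ge_1[OF cX T] B[of undefined] le
    by (intro mult_right_mono mult_left_mono) auto
  finally show ?thesis using False by (simp add: lag_weight_def)
qed

text \<open>\<open>S\<close> holds the indices already moved to the grid; its order condition makes
  it an initial segment in time. The induction undoes the most recent move, that of the latest index
  in \<open>S\<close>, which leaves an initial segment again. Only the two neighbouring times matter
  for that move, and their weights are bounded by a sum over all other indices; the terms with 0 and
  \<open>n\<close> stand for the initial time and for \<open>T\<close> when a neighbour is
  missing.\<close>

lemma replace_sample_times:
  fixes t :: "nat \<Rightarrow> real" and c :: "nat \<Rightarrow> nat" and x :: "real ^ 'd"
  assumes cX: "condition_X P X p C" and T: "T > 0" and n: "n > 0"
    and h [measurable]: "h \<in> borel_measurable borel" and H: "\<And>y. \<bar>h y\<bar> \<le> H"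
    and f [measurable]: "f \<in> borel_measurable borel" and F: "\<And>y. \<bar>f y\<bar> \<le> F"
    and c: "\<And>i. i < k \<Longrightarrow> real (c i) * T / real n \<le> t i"
    and c': "\<And>i. i < k \<Longrightarrow> t i < (real (c i) + 1) * T / real n"
    and tT: "\<And>i. i < k \<Longrightarrow> t i \<le> T"
    and S: "S \<subseteq> {..<k}" "\<And>i j. i \<in> S \<Longrightarrow> j \<in> {..<k} - S \<Longrightarrow> t i \<le> t j"
  defines "D \<equiv> \<lambda>S. \<integral>\<omega>. (\<Prod>i<k. h (X (if i \<in> S then real (c i) * T / real n else t i) \<omega>)) * f (X T \<omega>) \<partial>P x"
    and "w \<equiv> cell_weight (C T)"
  shows "\<bar>D {} - D S\<bar> \<le> H ^ k * F *
    (\<Sum>i\<in>S. (\<Sum>j\<in>{..<k} - {i}. w (c i) (c j)) + w (c i) 0 + w (c i) n)"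
  using S
proof (induction "card S" arbitrary: S)
  case 0
  then have "S = {}" using finite_subset[of S "{..<k}"] by auto
  then show ?case by simp
next
  case (Suc m)
  note S = Suc.prems
  have finS: "finite S" using S(1) by (rule finite_subset) simp
  then obtain i where i: "i \<in> S" and i_max: "\<And>j. j \<in> S \<Longrightarrow> t j \<le> t i"
    using Suc.hyps(2) arg_min_if_finite(1)[of S "\<lambda>j. - t j"] arg_min_least[of S _ "\<lambda>j. - t j"]
    by (metis card.empty nat.distinct(1) neg_le_iff_le)
  define S' J where "S' = S - {i}" and "J = {..<k} - S"
  define \<delta> where "\<delta> = T / real n"
  have \<delta>: "0 < \<delta>" using T n by (simp add: \<delta>_def)
  have ik: "i < k" using i S by auto
  have S'k: "j < k" if "j \<in> S'" for j using that S by (auto simp: S'_def)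
  have Jk: "j < k" if "j \<in> J" for j using that by (simp add: J_def)
  have finJ: "finite J" and finS': "finite S'" using finS by (simp_all add: J_def S'_def)
  have split: "{..<k} = insert i (S' \<union> J)" "i \<notin> S'" "i \<notin> J" "S' \<inter> J = {}"
    using S i by (auto simp: S'_def J_def)
  have t_grid: "real (c j) * \<delta> \<le> t j" "t j < (real (c j) + 1) * \<delta>" if "j < k" for j
    using c c' that by (simp_all add: \<delta>_def)
  have t_nonneg: "0 \<le> t j" if "j < k" for j
    using t_grid(1)[OF that] \<delta> by (smt (verit) mult_nonneg_nonneg of_nat_0_le_iff)
  have w_nonneg: "0 \<le> w a b" for a b
    using condition_X_const_ge_1[OF cX T] by (simp add: w_def cell_weight_nonneg)
  have H0: "0 \<le> H" and F0: "0 \<le> F" using H[of undefined] F[of undefined] by linarith+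
  define s where "s = real (c i) * \<delta>"
  have st: "0 \<le> s" "s \<le> t i" "t i \<le> s + \<delta>" "t i \<le> T"
    using t_grid[OF ik] \<delta> tT[OF ik] by (auto simp: s_def distrib_right)

  \<comment> \<open>Previous and next evaluation times around index \<open>i\<close>: moved points
    count with their grid times, unmoved ones with their original times, and 0 and \<open>T\<close>
    serve as defaults.\<close>
  define r where "r = Max (insert 0 ((\<lambda>j. real (c j) * \<delta>) ` S'))"
  define \<tau> where "\<tau> = Min (insert T (t ` J))"
  have r0: "0 \<le> r" and r_ge: "j \<in> S' \<Longrightarrow> real (c j) * \<delta> \<le> r" for j
    unfolding r_def using finS' by (auto intro: Max_ge)
  have \<tau>T: "\<tau> \<le> T" and \<tau>_le: "j \<in> J \<Longrightarrow> \<tau> \<le> t j" for j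
    using finJ by (auto simp: \<tau>_def)
  have "r \<in> insert 0 ((\<lambda>j. real (c j) * \<delta>) ` S')"
    unfolding r_def using finS' by (intro Max_in) auto
  then have "r = real 0 * \<delta> \<or> (\<exists>j\<in>S'. r = real (c j) * \<delta>)" by auto
  then obtain cr where cr: "r = real cr * \<delta>" "cr = 0 \<or> (\<exists>j\<in>S'. cr = c j)" by blast
  have "\<tau> \<in> insert T (t ` J)"
    unfolding \<tau>_def using finJ by (intro Min_in) auto
  \<comment> \<open>The next time need not lie on the grid, so it is only bounded below by the left
    end of its cell. The time \<open>T\<close> counts as the left end of an additional cell
    \<open>n\<close>.\<close>
  then have "real n * \<delta> \<le> \<tau> \<or> (\<exists>j\<in>J. real (c j) * \<delta> \<le> \<tau>)"
    using t_grid(1) Jk n by (auto simp: \<delta>_def)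
  then obtain c\<tau> where c\<tau>: "real c\<tau> * \<delta> \<le> \<tau>" "c\<tau> = n \<or> (\<exists>j\<in>J. c\<tau> = c j)" by blast
  have cell_mono: "c j \<le> c l" if "j < k" "l < k" "t j \<le> t l" for j l
  proof -
    have "real (c j) * \<delta> < (real (c l) + 1) * \<delta>"
      using t_grid[OF that(1)] t_grid[OF that(2)] that(3) by linarith
    then show ?thesis using \<delta> by simp
  qed
  have "real (c j) * \<delta> \<le> s" if "j \<in> S'" for j
    using cell_mono[OF S'k[OF that] ik] i_max that \<delta> by (simp add: s_def S'_def)
  then have rs: "r \<le> s"
    unfolding r_def using finS' st by auto
  have t_le: "t i \<le> t j" if "j \<in> J" for j
    using S(2)[OF i] that by (simp add: J_def)
  then have t\<tau>: "t i \<le> \<tau>"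
    unfolding \<tau>_def using finJ st by auto
  have "real (c i) * \<delta> \<le> real n * \<delta>"
    using st n by (simp add: s_def \<delta>_def)
  then have "c i \<le> n" using \<delta> by simp
  then have c\<tau>_ge: "c i \<le> c\<tau>"
    using c\<tau>(2) cell_mono[OF ik Jk] t_le by auto

  define A where "A \<omega> = (\<Prod>j\<in>S'. h (X (real (c j) * \<delta>) \<omega>))" for \<omega>
  have A_meas: "A \<in> borel_measurable (past M X r)"
    unfolding A_def using r_ge \<delta> by (intro borel_measurable_prod measurable_compose[OF measurable_X_past h]) auto
  have A_bound: "\<bar>A \<omega>\<bar> \<le> H ^ card S'" for \<omega>
    unfolding A_def abs_prod using H
    by (simp only: prod_constant[symmetric]) (intro prod_mono, simp)
  let ?\<phi> = "\<lambda>j. if j = k then f else h" and ?t = "\<lambda>j. if j = k then T else t j"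
  have kJ: "k \<notin> J" by (simp add: J_def)
  have "\<exists>g \<in> borel_measurable borel. (\<forall>y. \<bar>g y\<bar> \<le> (\<Prod>j\<in>insert k J. if j = k then F else H)) \<and>
    (\<forall>x Z a. Z \<in> borel_measurable (past M X \<tau>) \<longrightarrow> (\<forall>\<omega>. \<bar>Z \<omega>\<bar> \<le> a) \<longrightarrow>
      (\<integral>\<omega>. Z \<omega> * (\<Prod>j\<in>insert k J. ?\<phi> j (X (?t j) \<omega>)) \<partial>P x) = (\<integral>\<omega>. Z \<omega> * g (X \<tau> \<omega>) \<partial>P x))"
  proof (rule markov_integral_prod)
    show "finite (insert k J)" using finJ by simp
    show "0 \<le> \<tau>" using st t\<tau> by linarith
    show "\<tau> \<le> ?t j" if "j \<in> insert k J" for j using that \<tau>T \<tau>_le by auto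
    show "?\<phi> j \<in> borel_measurable borel" for j by simp
    show "\<bar>?\<phi> j y\<bar> \<le> (if j = k then F else H)" for j y using H F by simp
  qed
  then obtain g where g [measurable]: "g \<in> borel_measurable borel"
    and g_le: "\<forall>y. \<bar>g y\<bar> \<le> (\<Prod>j\<in>insert k J. if j = k then F else H)"
    and g_int: "\<forall>x Z a. Z \<in> borel_measurable (past M X \<tau>) \<longrightarrow> (\<forall>\<omega>. \<bar>Z \<omega>\<bar> \<le> a) \<longrightarrow>
      (\<integral>\<omega>. Z \<omega> * (\<Prod>j\<in>insert k J. ?\<phi> j (X (?t j) \<omega>)) \<partial>P x) = (\<integral>\<omega>. Z \<omega> * g (X \<tau> \<omega>) \<partial>P x)"
    by (elim bexE conjE)
  have "(\<Prod>j\<in>insert k J. if j = k then F else H) = F * H ^ card J"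
    using finJ kJ by (subst prod.insert) (auto intro!: prod.cong simp flip: prod_constant)
  with g_le have G: "\<bar>g y\<bar> \<le> F * H ^ card J" for y by simp
  have future: "(\<Prod>j\<in>insert k J. ?\<phi> j (X (?t j) \<omega>)) = (\<Prod>j\<in>J. h (X (t j) \<omega>)) * f (X T \<omega>)" for \<omega>
    using finJ kJ by (subst prod.insert) (auto intro!: prod.cong simp: mult.commute)
  \<comment> \<open>Stated for any \<open>R\<close> so that it gives the expectation before the move
    (\<open>u = t i\<close>) and after it (\<open>u = s\<close>) with the same past \<open>A\<close>
    and the same future \<open>g\<close>.\<close>
  have D_eq: "(\<integral>\<omega>. (\<Prod>i<k. h (X (if i \<in> R then real (c i) * T / real n else t i) \<omega>)) * f (X T \<omega>) \<partial>P x)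
      = (\<integral>\<omega>. A \<omega> * (h (X u \<omega>) * g (X \<tau> \<omega>)) \<partial>P x)"
    if R: "S' \<subseteq> R" "R \<inter> J = {}" and u: "0 \<le> u" "u \<le> t i" "u = (if i \<in> R then real (c i) * T / real n else t i)" for R u
  proof -
    have "(\<Prod>i<k. h (X (if i \<in> R then real (c i) * T / real n else t i) \<omega>)) * f (X T \<omega>)
        = A \<omega> * h (X u \<omega>) * (\<Prod>j\<in>insert k J. ?\<phi> j (X (?t j) \<omega>))" for \<omega>
    proof -
      have "(\<Prod>j\<in>S'. h (X (if j \<in> R then real (c j) * T / real n else t j) \<omega>)) = A \<omega>"
        unfolding A_def using R by (intro prod.cong) (auto simp: \<delta>_def)
      moreover have "(\<Prod>j\<in>J. h (X (if j \<in> R then real (c j) * T / real n else t j) \<omega>)) = (\<Prod>j\<in>J. h (X (t j) \<omega>))"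
        using R by (intro prod.cong) auto
      ultimately show ?thesis
        unfolding future split(1) using split(2-4) finS' finJ u(3)
        by (simp add: prod.union_disjoint mult_ac)
    qed
    moreover have "(\<lambda>\<omega>. A \<omega> * h (X u \<omega>)) \<in> borel_measurable (past M X \<tau>)"
      using u rs t\<tau> st measurable_past_mono[OF A_meas]
      by (intro borel_measurable_times measurable_compose[OF measurable_X_past h]) auto
    moreover have "\<bar>A \<omega> * h (X u \<omega>)\<bar> \<le> H ^ card S' * H" for \<omega>
      unfolding abs_mult using A_bound H H0 by (intro mult_mono) auto
    ultimately show ?thesis
      using g_int[rule_format, of "\<lambda>\<omega>. A \<omega> * h (X u \<omega>)" "H ^ card S' * H" x] by (simp add: mult.assoc)
  qed
  have D_S': "D S' = (\<integral>\<omega>. A \<omega> * (h (X (t i) \<omega>) * g (X \<tau> \<omega>)) \<partial>P x)"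
    unfolding D_def using st by (intro D_eq) (auto simp: S'_def J_def)
  have D_S: "D S = (\<integral>\<omega>. A \<omega> * (h (X s \<omega>) * g (X \<tau> \<omega>)) \<partial>P x)"
    unfolding D_def using st i by (intro D_eq) (auto simp: S'_def J_def s_def \<delta>_def)

  have "\<bar>D S' - D S\<bar> \<le> H ^ card S' * (H * (F * H ^ card J)) * (w (c i) cr + w (c i) c\<tau>)"
    unfolding D_S' D_S
  proof (rule three_point_increment[OF A_meas A_bound h H g G r0 rs st(2) t\<tau>])
    fix \<phi> :: "real ^ 'd \<Rightarrow> real" and B z assume \<phi>: "\<phi> \<in> borel_measurable borel" "\<And>y. \<bar>\<phi> y\<bar> \<le> B"
    have "cr \<le> c i" using rs \<delta> by (simp add: cr(1) s_def)
    then show "\<bar>transition_op (t i - r) \<phi> z - transition_op (s - r) \<phi> z\<bar> \<le> w (c i) cr * B"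
      unfolding w_def cell_weight_def using st rs r0
      by (intro transition_op_cell_increment[OF cX T n \<phi>])
         (auto simp: cr(1) s_def \<delta>_def of_nat_diff left_diff_distrib diff_divide_distrib)
    show "\<bar>transition_op (\<tau> - s) \<phi> z - transition_op (\<tau> - t i) \<phi> z\<bar> \<le> w (c i) c\<tau> * B"
    proof -
      \<comment> \<open>The first branch can only mean equal cells, hence lag 0. In the other branch
        one cell is lost because \<open>t i\<close> may lie anywhere below the right end of its
        cell.\<close>
      let ?m = "if c\<tau> \<le> c i then c i - c\<tau> else c\<tau> - c i - 1"
      have "real ?m * \<delta> \<le> \<tau> - t i"
      proof (cases "c\<tau> \<le> c i")
        case False
        then have "real ?m * \<delta> = real c\<tau> * \<delta> - (real (c i) + 1) * \<delta>"
          by (simp add: of_nat_diff left_diff_distrib algebra_simps)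
        then show ?thesis using c\<tau>(1) t_grid(2)[OF ik] by linarith
      qed (use c\<tau>_ge t\<tau> in simp)
      then show ?thesis
        unfolding w_def cell_weight_def using st t\<tau> \<tau>T
        by (intro transition_op_cell_increment[OF cX T n \<phi>]) (auto simp: \<delta>_def)
    qed
  qed
  also have "H ^ card S' * (H * (F * H ^ card J)) = H ^ k * F"
  proof -
    have "k = card (insert i (S' \<union> J))" using split(1) by (metis card_lessThan)
    also have "\<dots> = Suc (card S' + card J)"
      using split finS' finJ by (simp add: card_Un_disjoint)
    finally show ?thesis by (simp add: power_add mult_ac)
  qed
  also have "H ^ k * F * (w (c i) cr + w (c i) c\<tau>)
      \<le> H ^ k * F * ((\<Sum>j\<in>{..<k} - {i}. w (c i) (c j)) + w (c i) 0 + w (c i) n)"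
  proof (intro mult_left_mono)
    have "w (c i) cr \<le> w (c i) 0 + (\<Sum>j\<in>S'. w (c i) (c j))"
      using cr(2)
    proof
      assume "\<exists>j\<in>S'. cr = c j"
      then show ?thesis
        using finS' w_nonneg by (auto intro!: member_le_sum add_increasing)
    qed (use w_nonneg in \<open>simp add: sum_nonneg\<close>)
    moreover have "w (c i) c\<tau> \<le> w (c i) n + (\<Sum>j\<in>J. w (c i) (c j))"
      using c\<tau>(2)
    proof
      assume "\<exists>j\<in>J. c\<tau> = c j"
      then show ?thesis
        using finJ w_nonneg by (auto intro!: member_le_sum add_increasing)
    qed (use w_nonneg in \<open>simp add: sum_nonneg\<close>)
    moreover have "{..<k} - {i} = S' \<union> J" using split by auto
    then have "(\<Sum>j\<in>{..<k} - {i}. w (c i) (c j)) = (\<Sum>j\<in>S'. w (c i) (c j)) + (\<Sum>j\<in>J. w (c i) (c j))"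
      using split finS' finJ by (simp add: sum.union_disjoint)
    ultimately show "w (c i) cr + w (c i) c\<tau> \<le> (\<Sum>j\<in>{..<k} - {i}. w (c i) (c j)) + w (c i) 0 + w (c i) n"
      by linarith
  qed (use H0 F0 in simp)
  finally have step: "\<bar>D S' - D S\<bar> \<le> H ^ k * F * ((\<Sum>j\<in>{..<k} - {i}. w (c i) (c j)) + w (c i) 0 + w (c i) n)" .
  have "\<bar>D {} - D S'\<bar> \<le> H ^ k * F *
    (\<Sum>i\<in>S'. (\<Sum>j\<in>{..<k} - {i}. w (c i) (c j)) + w (c i) 0 + w (c i) n)"
    using Suc.hyps(2) i finS S i_max by (intro Suc.hyps(1)) (auto simp: S'_def)
  then show ?case
    using step finS i by (simp add: sum.remove[OF finS i] S'_def[symmetric] distrib_left)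
qed

end

section \<open>Harmonic sums of the weights\<close>

lemma sum_lag_weight: "(\<Sum>m<Suc n. lag_weight c m) = c * (2 + harm n)"
proof (induction n)
  case (Suc n)
  then show ?case by (simp add: lag_weight_def harm_Suc inverse_eq_divide distrib_left)
qed (simp add: lag_weight_def harm_expand)

text \<open>The sequence \<open>harm n - ln n\<close> decreases from its value 1 at
  \<open>n = 1\<close>, so \<open>harm n\<close> is at most \<open>1 + ln n\<close>; the remaining 2
  is the weight of lag 0.\<close>

lemma sum_lag_weight_le:
  assumes "0 \<le> c" "0 < n" "L \<le> n"
  shows "(\<Sum>m<L. lag_weight c m) \<le> c * (3 + ln (real n))"
proof -
  have "(\<Sum>m<L. lag_weight c m) \<le> (\<Sum>m<Suc n. lag_weight c m)"
    using assms by (intro sum_mono2) (auto intro: lag_weight_nonneg)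
  also have "\<dots> \<le> c * (3 + ln (real n))"
    unfolding sum_lag_weight using euler_mascheroni_sequence_decreasing[of 1 n] assms
    by (intro mult_left_mono) (auto simp: harm_expand)
  finally show ?thesis .
qed

text \<open>The cells before \<open>b\<close> run through the lags below \<open>b\<close>, and those
  from \<open>b\<close> on through the lags below \<open>n - b\<close>; lag 0 occurs once on each
  side.\<close>

lemma sum_cell_weight:
  assumes "b \<le> n"
  shows "(\<Sum>a<n. cell_weight c a b) = (\<Sum>m<b. lag_weight c m) + (\<Sum>m<n - b. lag_weight c m)"
proof -
  have "{..<n} = {..<b} \<union> {b..<n}" using assms by auto
  then have "(\<Sum>a<n. cell_weight c a b) = (\<Sum>a<b. cell_weight c a b) + (\<Sum>a\<in>{b..<n}. cell_weight c a b)"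
    by (simp add: sum.union_disjoint ivl_disj_int)
  also have "(\<Sum>a<b. cell_weight c a b) = (\<Sum>a<b. lag_weight c (b - Suc a))"
    by (intro sum.cong) (auto simp: cell_weight_def)
  also have "\<dots> = (\<Sum>m<b. lag_weight c m)"
    by (rule sum.nat_diff_reindex)
  also have "(\<Sum>a\<in>{b..<n}. cell_weight c a b) = (\<Sum>m<n - b. lag_weight c m)"
    by (simp add: sum.atLeastLessThan_shift_0[of _ b n] cell_weight_def atLeast0LessThan)
  finally show ?thesis .
qed

lemma sum_cell_weight_le:
  assumes "0 \<le> c" "0 < n" "b \<le> n"
  shows "(\<Sum>a<n. cell_weight c a b) \<le> 2 * c * (3 + ln (real n))"
  unfolding sum_cell_weight[OF assms(3)]
  using sum_lag_weight_le[OF assms] sum_lag_weight_le[OF assms(1,2), of "n - b"] by simp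

text \<open>Each end of the grid sees lags on one side only, so both ends together cost no more than
  the bound for one interior cell.\<close>

lemma sum_cell_weight_ends_le:
  assumes "0 \<le> c" "0 < n"
  shows "(\<Sum>a<n. cell_weight c a 0 + cell_weight c a n) \<le> 2 * c * (3 + ln (real n))"
  unfolding sum.distrib using sum_lag_weight_le[OF assms, of n]
  by (simp add: sum_cell_weight)

section \<open>Uniform random times and grid cells\<close>

text \<open>A total version of the sample time: values outside the half-open interval, which the
  uniform law does not charge, are sent to 0. Bounds on times and cells then hold everywhere and not
  just almost everywhere.\<close>

definition clip :: "real \<Rightarrow> real \<Rightarrow> real" where
  "clip T s = (if 0 \<le> s \<and> s < T then s else 0)"

definition cell :: "real \<Rightarrow> nat \<Rightarrow> real \<Rightarrow> nat" where
  "cell T n s = nat \<lfloor>clip T s * real n / T\<rfloor>"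

lemma measurable_clip [measurable]: "clip T \<in> borel_measurable borel"
  unfolding clip_def[abs_def] by measurable

lemma measurable_cell [measurable]: "cell T n \<in> measurable borel (count_space UNIV)"
  unfolding cell_def[abs_def] by measurable

lemma clip_bounds:
  assumes "0 < T"
  shows "0 \<le> clip T s" "clip T s < T"
  using assms by (auto simp: clip_def)

lemma cell_bounds:
  assumes "0 < T" "0 < n"
  shows "real (cell T n s) * T / real n \<le> clip T s"
    and "clip T s < (real (cell T n s) + 1) * T / real n"
    and "cell T n s < n"
proof -
  let ?y = "clip T s * real n / T"
  have y: "0 \<le> ?y" "?y < real n"
    using clip_bounds[OF assms(1), of s] assms by (auto simp: field_simps)
  then have *: "real (cell T n s) \<le> ?y" "?y < real (cell T n s) + 1"
    by (simp_all add: cell_def)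
  then show "real (cell T n s) * T / real n \<le> clip T s" "clip T s < (real (cell T n s) + 1) * T / real n"
    using assms by (auto simp: field_simps)
  show "cell T n s < n" using * y by linarith
qed

lemma cell_eq_iff:
  assumes "0 < T" "0 < n" "0 \<le> s" "s < T"
  shows "cell T n s = a \<longleftrightarrow> real a * T / real n \<le> s \<and> s < (real a + 1) * T / real n"
proof -
  let ?y = "s * real n / T"
  have "cell T n s = a \<longleftrightarrow> real a \<le> ?y \<and> ?y < real a + 1"
    using assms by (auto simp: cell_def clip_def) linarith
  also have "\<dots> \<longleftrightarrow> real a * T / real n \<le> s \<and> s < (real a + 1) * T / real n"
    using assms by (auto simp: field_simps)
  finally show ?thesis .
qed

definition sample_time :: "real \<Rightarrow> real measure" where
  "sample_time T = uniform_measure lborel {0..<T}"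

lemma sets_sample_time [simp, measurable_cong]: "sets (sample_time T) = sets borel"
  by (simp add: sample_time_def)

lemma space_sample_time [simp]: "space (sample_time T) = UNIV"
  by (simp add: sample_time_def)

lemma prob_space_sample_time: "0 < T \<Longrightarrow> prob_space (sample_time T)"
  unfolding sample_time_def by (intro prob_space_uniform_measure) auto

lemma integral_sample_time:
  fixes F :: "real \<Rightarrow> real"
  assumes "0 < T" and [measurable]: "F \<in> borel_measurable borel"
  shows "T * (\<integral>s. F s \<partial>sample_time T) = (\<integral>s. indicator {0..<T} s * F s \<partial>lborel)"
proof -
  have "sample_time T = density lborel (\<lambda>s. ennreal (indicator {0..<T} s / T))"
    unfolding sample_time_def uniform_measure_def using assms(1)
    by (intro density_cong) (auto simp: indicator_def divide_ennreal simp flip: ennreal_1)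
  then have "(\<integral>s. F s \<partial>sample_time T) = (\<integral>s. indicator {0..<T} s / T * F s \<partial>lborel)"
    using assms(1) by (simp add: integral_density)
  also have "\<dots> = (\<integral>s. indicator {0..<T} s * F s \<partial>lborel) / T"
    by simp
  finally show ?thesis using assms(1) by simp
qed

text \<open>A uniform time falls into each of the \<open>n\<close> cells with probability
  \<open>1 / n\<close>, so its cell index is uniform.\<close>

lemma integral_cell:
  fixes F :: "nat \<Rightarrow> real"
  assumes T: "0 < T" and n: "0 < n"
  shows "(\<integral>s. F (cell T n s) \<partial>sample_time T) = (\<Sum>a<n. F a) / real n"
proof -
  interpret prob_space "sample_time T" using T by (rule prob_space_sample_time)
  have cell_sets [measurable]: "{s. cell T n s = a} \<in> sets borel" for a
    using measurable_sets[OF measurable_cell[of T n], of "{a}"] by (simp add: vimage_def)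
  have prob: "prob {s. cell T n s = a} = 1 / real n" if "a < n" for a
  proof -
    have "(real a + 1) * T / real n \<le> T" using that T n by (simp add: field_simps flip: of_nat_Suc)
    moreover have "0 \<le> real a * T / real n" using T by simp
    ultimately have "{0..<T} \<inter> {s. cell T n s = a} = {real a * T / real n..<(real a + 1) * T / real n}"
      using cell_eq_iff[OF T n, of _ a] by fastforce
    then show ?thesis
      using T n cell_sets[of a] unfolding sample_time_def
      by (subst measure_uniform_measure) (auto simp: divide_right_mono field_simps)
  qed
  have "F (cell T n s) = (\<Sum>a<n. F a * indicator {s. cell T n s = a} s)" for s
    using cell_bounds(3)[OF T n, of s] by (simp add: indicator_def if_distrib sum.delta cong: if_cong)
  then have "(\<integral>s. F (cell T n s) \<partial>sample_time T)
      = (\<integral>s. (\<Sum>a<n. F a * indicator {s. cell T n s = a} s) \<partial>sample_time T)"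
    by (rule Bochner_Integration.integral_cong[OF refl])
  also have "\<dots> = (\<Sum>a<n. F a * prob {s. cell T n s = a})"
    by (subst Bochner_Integration.integral_sum) (auto simp: emeasure_eq_measure)
  also have "\<dots> = (\<Sum>a<n. F a) / real n"
    by (simp add: prob sum_divide_distrib)
  finally show ?thesis .
qed

text \<open>Integrate over coordinate \<open>i\<close> first, with the others frozen: its cell index
  is uniform, so the sums over cells apply. The other \<open>k - 1\<close> coordinates contribute
  one bound each and the two ends together one more, which makes \<open>k\<close>.\<close>

lemma integral_cell_weight_sum_le:
  fixes k n i :: nat
  assumes c: "0 \<le> c" and T: "0 < T" and n: "0 < n" and i: "i < k"
  defines "\<phi> \<equiv> \<lambda>t. (\<Sum>j\<in>{..<k} - {i}. cell_weight c (cell T n (t i)) (cell T n (t j)))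
    + cell_weight c (cell T n (t i)) 0 + cell_weight c (cell T n (t i)) n"
  shows "integrable (Pi\<^sub>M {..<k} (\<lambda>_. sample_time T)) \<phi>"
    and "(\<integral>t. \<phi> t \<partial>Pi\<^sub>M {..<k} (\<lambda>_. sample_time T)) \<le> real k * (2 * c * (3 + ln (real n))) / real n"
proof -
  interpret finite_product_prob_space "\<lambda>_. sample_time T" "{..<k}"
    using prob_space_sample_time[OF T]
    by (auto simp: finite_product_prob_space_def product_prob_space_def product_prob_space_axioms_def
      finite_product_sigma_finite_def finite_product_sigma_finite_axioms_def product_sigma_finite_def
      prob_space_imp_sigma_finite)
  let ?K = "2 * c * (3 + ln (real n))"
  have cell_meas: "(\<lambda>t. cell T n (t j)) \<in> measurable (Pi\<^sub>M {..<k} (\<lambda>_. sample_time T)) (count_space UNIV)"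
    if "j < k" for j
    using that by (intro measurable_compose[OF measurable_component_singleton[of j]]) simp_all
  have w_meas: "(\<lambda>t. cell_weight c (a t) (b t)) \<in> borel_measurable N"
    if "a \<in> measurable N (count_space UNIV)" "b \<in> measurable N (count_space UNIV)" for a b and N :: "(nat \<Rightarrow> real) measure"
  proof -
    have "(\<lambda>t. (a t, b t)) \<in> measurable N (count_space UNIV)"
      using that by (intro measurable_compose_countable'[where f="\<lambda>x t. (x, b t)" and g=a and I=UNIV]) auto
    from measurable_compose[OF this, of "case_prod (cell_weight c)" borel] show ?thesis by simp
  qed
  have meas [measurable]: "\<phi> \<in> borel_measurable (Pi\<^sub>M {..<k} (\<lambda>_. sample_time T))"
    unfolding \<phi>_def using i by (intro borel_measurable_add borel_measurable_sum w_meas cell_meas) auto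
  have "(if m = 0 then 2 else 1 / real m) \<le> 2" for m by (simp add: divide_le_eq)
  from mult_left_mono[OF this c] have lag_le: "lag_weight c m \<le> 2 * c" for m
    by (simp add: lag_weight_def mult.commute)
  with c have w_le: "0 \<le> cell_weight c a b" "cell_weight c a b \<le> 2 * c" for a b
    by (simp_all add: cell_weight_def lag_weight_nonneg)
  have "0 \<le> \<phi> t" for t
    unfolding \<phi>_def by (intro add_nonneg_nonneg sum_nonneg w_le)
  moreover have "\<phi> t \<le> (\<Sum>j\<in>{..<k} - {i}. 2 * c) + 2 * c + 2 * c" for t
    unfolding \<phi>_def by (intro add_mono sum_mono w_le)
  ultimately show int: "integrable (Pi\<^sub>M {..<k} (\<lambda>_. sample_time T)) \<phi>"
    by (intro integrable_const_bound[OF _ meas]) (auto simp: abs_of_nonneg)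
  let ?I = "{..<k} - {i}"
  have ins: "insert i ?I = {..<k}" using i by auto
  have inner: "(\<integral>s. \<phi> (t(i := s)) \<partial>sample_time T) \<le> real k * ?K / real n" for t
  proof -
    have "\<phi> (t(i := s)) = (\<Sum>j\<in>?I. cell_weight c (cell T n s) (cell T n (t j)))
        + (cell_weight c (cell T n s) 0 + cell_weight c (cell T n s) n)" for s
      by (auto simp: \<phi>_def intro!: sum.cong)
    then have "(\<integral>s. \<phi> (t(i := s)) \<partial>sample_time T) = (\<Sum>a<n. (\<Sum>j\<in>?I. cell_weight c a (cell T n (t j)))
        + (cell_weight c a 0 + cell_weight c a n)) / real n"
      using integral_cell[OF T n, of "\<lambda>a. (\<Sum>j\<in>?I. cell_weight c a (cell T n (t j)))
        + (cell_weight c a 0 + cell_weight c a n)"] by simp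
    also have "\<dots> = ((\<Sum>j\<in>?I. \<Sum>a<n. cell_weight c a (cell T n (t j)))
        + (\<Sum>a<n. cell_weight c a 0 + cell_weight c a n)) / real n"
      by (subst sum.swap) (simp add: sum.distrib)
    also have "\<dots> \<le> ((\<Sum>j\<in>?I. ?K) + ?K) / real n"
      using cell_bounds(3)[OF T n]
      by (intro divide_right_mono add_mono sum_mono sum_cell_weight_le sum_cell_weight_ends_le c n) (auto intro: less_imp_le)
    also have "(\<Sum>j\<in>?I. ?K) + ?K = real k * ?K"
      using i by (simp add: of_nat_diff left_diff_distrib)
    finally show ?thesis .
  qed
  interpret I: prob_space "Pi\<^sub>M ?I (\<lambda>_. sample_time T)"
    by (rule prob_space_PiM) (rule prob_space_sample_time[OF T])
  have "(\<integral>t. \<phi> t \<partial>Pi\<^sub>M {..<k} (\<lambda>_. sample_time T))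
      = (\<integral>t. (\<integral>s. \<phi> (t(i := s)) \<partial>sample_time T) \<partial>Pi\<^sub>M ?I (\<lambda>_. sample_time T))"
    by (rule product_integral_insert[of ?I i \<phi>, unfolded ins, OF _ _ int]) simp_all
  also have "\<dots> \<le> real k * ?K / real n"
  proof (cases "integrable (Pi\<^sub>M ?I (\<lambda>_. sample_time T)) (\<lambda>t. \<integral>s. \<phi> (t(i := s)) \<partial>sample_time T)")
    case True
    then show ?thesis using inner by (intro I.integral_le_const) auto
  next
    \<comment> \<open>No integrability of the inner integral has to be shown: otherwise the outer
      integral is 0 by convention, and the bound is nonnegative.\<close>
    case False
    have "0 \<le> ln (real n)" using n by simp
    with False c show ?thesis by (simp add: not_integrable_integral_eq)
  qed
  finally show "(\<integral>t. \<phi> t \<partial>Pi\<^sub>M {..<k} (\<lambda>_. sample_time T)) \<le> real k * ?K / real n" .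
qed

section \<open>Powers of the functionals as averages over random times\<close>

lemma measurable_process_compose:
  assumes "measurable_process M X" "\<theta> \<in> borel_measurable N" "\<And>z. 0 \<le> \<theta> z" "g \<in> measurable N M"
  shows "(\<lambda>z. X (\<theta> z) (g z)) \<in> borel_measurable N"
proof -
  have "(\<lambda>z. (\<theta> z, g z)) \<in> measurable N (restrict_space borel {0..} \<Otimes>\<^sub>M M)"
    using assms(2-4) by (intro measurable_Pair measurable_restrict_space2) auto
  from measurable_compose[OF this assms(1)[unfolded measurable_process_def]] show ?thesis
    by simp
qed

lemma int_functional_eq_sample:
  assumes X: "measurable_process M X" and [measurable]: "h \<in> borel_measurable borel"
    and T: "0 < T" and \<omega>: "\<omega> \<in> space M"
  shows "int_functional X h T \<omega> = T * (\<integral>s. h (X (clip T s) \<omega>) \<partial>sample_time T)"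
proof -
  have meas: "(\<lambda>s. h (X (\<theta> s) \<omega>)) \<in> borel_measurable borel"
    if "\<theta> \<in> borel_measurable borel" "\<And>s. 0 \<le> \<theta> s" for \<theta> :: "real \<Rightarrow> real"
    using measurable_process_compose[OF X that, of "\<lambda>_. \<omega>"] \<omega> by simp
  note [measurable] = meas[OF measurable_clip clip_bounds(1)[OF T]] meas[of "\<lambda>s. max 0 s", simplified]
  have "T * (\<integral>s. h (X (clip T s) \<omega>) \<partial>sample_time T)
      = (\<integral>s. indicator {0..<T} s * h (X (clip T s) \<omega>) \<partial>lborel)"
    using T by (rule integral_sample_time) measurable
  \<comment> \<open>Including the endpoint \<open>T\<close> changes a null set only. The argument
    \<open>max 0 s\<close> keeps the integrand measurable on the whole line, since the process is
    controlled at nonnegative times only.\<close>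
  also have "\<dots> = (\<integral>s. indicator {0..T} s * h (X (max 0 s) \<omega>) \<partial>lborel)"
  proof (rule integral_cong_AE)
    show "AE s in lborel. indicator {0..<T} s * h (X (clip T s) \<omega>) = indicator {0..T} s * h (X (max 0 s) \<omega>)"
      using AE_lborel_singleton[of T] by eventually_elim (auto simp: indicator_def clip_def)
  qed measurable
  also have "\<dots> = int_functional X h T \<omega>"
    unfolding int_functional_def set_lebesgue_integral_def
    by (intro Bochner_Integration.integral_cong) (auto simp: indicator_def)
  finally show ?thesis ..
qed

lemma int_sum_eq_sample:
  assumes "0 < T" "0 < n"
  shows "int_sum X h T n \<omega> = T * (\<integral>s. h (X (real (cell T n s) * T / real n) \<omega>) \<partial>sample_time T)"
  unfolding int_sum_def using integral_cell[OF assms, of "\<lambda>a. h (X (real a * T / real n) \<omega>)"] by simp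

context markov_process
begin

text \<open>The \<open>k\<close>-th power of an average is the average of the product over
  \<open>k\<close> independent copies; Fubini then exchanges it with the expectation. A general
  \<theta> covers both the integral functional (\<open>clip T\<close>) and the integral sum (left
  end of the cell).\<close>

lemma power_expectation_eq_product:
  fixes \<theta> :: "real \<Rightarrow> real" and h f :: "real ^ 'd \<Rightarrow> real" and k :: nat and x :: "real ^ 'd"
  assumes X: "measurable_process M X"
    and h [measurable]: "h \<in> borel_measurable borel" and H: "\<And>y. \<bar>h y\<bar> \<le> H"
    and f [measurable]: "f \<in> borel_measurable borel" and F: "\<And>y. \<bar>f y\<bar> \<le> F"
    and \<theta> [measurable]: "\<theta> \<in> borel_measurable borel" "\<And>s. 0 \<le> \<theta> s" and T: "0 < T"
  defines "D \<equiv> \<lambda>t. \<integral>\<omega>. (\<Prod>i<k. h (X (\<theta> (t i)) \<omega>)) * f (X T \<omega>) \<partial>P x"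
  shows "integrable (Pi\<^sub>M {..<k} (\<lambda>_. sample_time T)) D"
    and "(\<integral>\<omega>. (\<integral>s. h (X (\<theta> s) \<omega>) \<partial>sample_time T) ^ k * f (X T \<omega>) \<partial>P x)
      = (\<integral>t. D t \<partial>Pi\<^sub>M {..<k} (\<lambda>_. sample_time T))"
    and "\<bar>D t\<bar> \<le> H ^ k * F"
proof -
  interpret P: prob_space "P x" by (rule prob_space_P)
  interpret U: prob_space "sample_time T" using T by (rule prob_space_sample_time)
  interpret product_sigma_finite "\<lambda>_. sample_time T"
    by (simp add: product_sigma_finite_def U.sigma_finite_measure_axioms)
  let ?N = "Pi\<^sub>M {..<k} (\<lambda>_. sample_time T)"
  interpret N: prob_space ?N
    by (rule prob_space_PiM) (rule prob_space_sample_time[OF T])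
  interpret PN: pair_prob_space "P x" ?N ..
  have X': "measurable_process (P x) X"
    using X unfolding measurable_process_def
    by (subst measurable_cong_sets[OF sets_pair_measure_cong[OF refl sets_P] refl])
  let ?G = "\<lambda>\<omega> t. (\<Prod>i<k. h (X (\<theta> (t i)) \<omega>)) * f (X T \<omega>)"
  have H0: "0 \<le> H" using H[of undefined] by linarith
  have G_le: "\<bar>?G \<omega> t\<bar> \<le> H ^ k * F" for \<omega> t
  proof -
    have "\<bar>\<Prod>i<k. h (X (\<theta> (t i)) \<omega>)\<bar> \<le> (\<Prod>i<k. H)"
      unfolding abs_prod using H by (intro prod_mono) simp
    then show ?thesis unfolding abs_mult using F H0 by (intro mult_mono) auto
  qed
  have hX: "(\<lambda>z. h (X (\<theta> (snd z i)) (fst z))) \<in> borel_measurable (P x \<Otimes>\<^sub>M ?N)" if "i < k" for i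
  proof -
    have "(\<lambda>z. X (\<theta> (snd z i)) (fst z)) \<in> borel_measurable (P x \<Otimes>\<^sub>M ?N)"
      using that \<theta>(2) by (intro measurable_process_compose[OF X']) measurable
    then show ?thesis by measurable
  qed
  have [measurable]: "X T \<in> borel_measurable (P x)" using T by simp
  have G_meas: "case_prod ?G \<in> borel_measurable (P x \<Otimes>\<^sub>M ?N)"
    unfolding split_beta' using hX by (intro borel_measurable_times borel_measurable_prod) auto
  have G_int: "integrable (P x \<Otimes>\<^sub>M ?N) (case_prod ?G)"
    using G_le by (intro PN.integrable_const_bound[OF _ G_meas, of "H ^ k * F"]) auto
  have G_meas1: "?G \<omega> \<in> borel_measurable ?N" if "\<omega> \<in> space M" for \<omega>
    using measurable_compose[OF measurable_Pair1' G_meas] that by (simp add: space_P)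
  have G_meas2: "(\<lambda>\<omega>. ?G \<omega> t) \<in> borel_measurable (P x)" for t
    using \<theta>(2) by measurable
  show "integrable ?N D"
    unfolding D_def using PN.integrable_snd[OF G_int] .
  show "\<bar>D t\<bar> \<le> H ^ k * F"
    unfolding D_def using G_meas2 G_le by (rule abs_integral_P_le)
  have "(\<integral>s. h (X (\<theta> s) \<omega>) \<partial>sample_time T) ^ k * f (X T \<omega>) = (\<integral>t. ?G \<omega> t \<partial>?N)" if "\<omega> \<in> space M" for \<omega>
  proof -
    have "(\<lambda>s. h (X (\<theta> s) \<omega>)) \<in> borel_measurable (sample_time T)"
      using measurable_process_compose[OF X \<theta>, of "\<lambda>_. \<omega>"] that by simp
    then have "integrable (sample_time T) (\<lambda>s. h (X (\<theta> s) \<omega>))"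
      using H by (intro U.integrable_const_bound[of _ H]) auto
    from product_integral_prod[of "{..<k}", OF _ this] show ?thesis by simp
  qed
  then have "(\<integral>\<omega>. (\<integral>s. h (X (\<theta> s) \<omega>) \<partial>sample_time T) ^ k * f (X T \<omega>) \<partial>P x) = (\<integral>\<omega>. (\<integral>t. ?G \<omega> t \<partial>?N) \<partial>P x)"
    by (intro Bochner_Integration.integral_cong) (auto simp: space_P)
  also have "\<dots> = (\<integral>t. D t \<partial>?N)"
    unfolding D_def by (rule PN.Fubini_integral[OF G_int, symmetric])
  finally show "(\<integral>\<omega>. (\<integral>s. h (X (\<theta> s) \<omega>) \<partial>sample_time T) ^ k * f (X T \<omega>) \<partial>P x) = (\<integral>t. D t \<partial>?N)" .
qed

text \<open>The case where all \<open>k\<close> times have been moved, so that the order condition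
  on \<open>S\<close> is vacuous.\<close>

lemma product_expectation_cell_le:
  fixes t :: "nat \<Rightarrow> real" and k n :: nat and x :: "real ^ 'd"
  assumes cX: "condition_X P X p C" and T: "T > 0" and n: "n > 0"
    and h: "h \<in> borel_measurable borel" and H: "\<And>y. \<bar>h y\<bar> \<le> H"
    and f: "f \<in> borel_measurable borel" and F: "\<And>y. \<bar>f y\<bar> \<le> F"
  shows "\<bar>(\<integral>\<omega>. (\<Prod>i<k. h (X (clip T (t i)) \<omega>)) * f (X T \<omega>) \<partial>P x)
      - (\<integral>\<omega>. (\<Prod>i<k. h (X (real (cell T n (t i)) * T / real n) \<omega>)) * f (X T \<omega>) \<partial>P x)\<bar>
    \<le> H ^ k * F * (\<Sum>i<k. (\<Sum>j\<in>{..<k} - {i}. cell_weight (C T) (cell T n (t i)) (cell T n (t j)))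
        + cell_weight (C T) (cell T n (t i)) 0 + cell_weight (C T) (cell T n (t i)) n)"
proof -
  have "(\<Prod>i<k. h (X (if i \<in> {..<k} then real (cell T n (t i)) * T / real n else clip T (t i)) \<omega>))
      = (\<Prod>i<k. h (X (real (cell T n (t i)) * T / real n) \<omega>))" for \<omega>
    by (intro prod.cong) auto
  then show ?thesis
    using replace_sample_times[OF cX T n h H f F, of k "\<lambda>i. cell T n (t i)" "\<lambda>i. clip T (t i)" "{..<k}" x]
      cell_bounds[OF T n] clip_bounds[OF T]
    by (simp add: less_imp_le)
qed

end

section \<open>Numerical constants and conclusion\<close>

lemma abs_le_sup_norm:
  assumes "bounded (range g)"
  shows "\<bar>g y\<bar> \<le> sup_norm g"
proof -
  obtain B where "\<And>y. \<bar>g y\<bar> \<le> B"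
    using assms by (auto simp: bounded_iff)
  then show ?thesis
    unfolding sup_norm_def by (intro cSUP_upper bdd_aboveI[of _ B]) auto
qed

text \<open>Makes the trivial bound sufficient for small \<open>n\<close>. It rests on
  \<open>ln 2\<close> being at least 2/3 and \<open>ln 3\<close> at least 1; \<open>n = 4\<close>
  reduces to \<open>n = 2\<close>, since \<open>ln 4 / 4 = ln 2 / 2\<close>.\<close>

lemma two_le_six_log_ratio:
  assumes "n \<in> {2, 3, 4 :: nat}"
  shows "2 \<le> 6 * (ln (real n) / real n)"
proof -
  have "1 \<le> ln (3 :: real)"
    using e_less_272 by (subst ln_ge_iff) auto
  moreover have "ln (4 :: real) = 2 * ln 2"
    using ln_realpow[of 2 2] by simp
  ultimately show ?thesis
    using assms ln2_ge_two_thirds by auto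
qed

text \<open>Amounts to \<open>exp 3\<close> being at most the square of \<open>n\<close>. Since
  \<open>exp 3\<close> is about 20.1, this starts at \<open>n = 5\<close> and fails for 4.\<close>

lemma three_plus_log_le:
  assumes "5 \<le> (n :: nat)"
  shows "2 * (3 + ln (real n)) \<le> 6 * ln (real n)"
proof -
  have "exp (3 :: real) = exp 1 ^ 3" by (simp flip: exp_of_nat_mult)
  also have "\<dots> \<le> (272 / 100) ^ 3" using e_less_272 by (intro power_mono) auto
  also have "\<dots> \<le> 5 ^ 2" by (simp add: power_divide)
  finally have "3 \<le> ln (5 ^ 2 :: real)" by (subst ln_ge_iff) auto
  also have "\<dots> = 2 * ln 5" by (subst ln_realpow) auto
  also have "\<dots> \<le> 2 * ln (real n)" using assms by simp
  finally show ?thesis by simp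
qed

theorem theorem1:
  fixes M :: "'w measure"
    and P :: "real ^ 'd \<Rightarrow> 'w measure"
    and X :: "real \<Rightarrow> 'w \<Rightarrow> real ^ 'd"
    and p :: "real \<Rightarrow> real ^ 'd \<Rightarrow> real ^ 'd \<Rightarrow> real"
    and C :: "real \<Rightarrow> real"
    and h f :: "real ^ 'd \<Rightarrow> real"
    and T :: real and n k :: nat and x :: "real ^ 'd"
  assumes "markov_process M P X"
    and "measurable_process M X"
    and "condition_X P X p C"
    and "h \<in> borel_measurable borel" and "bounded (range h)"
    and "f \<in> borel_measurable borel" and "bounded (range f)"
    and "T > 0" and "n \<ge> 2"
  shows "\<bar>(\<integral>\<omega>. int_functional X h T \<omega> ^ k * f (X T \<omega>) \<partial>P x)
          - (\<integral>\<omega>. int_sum X h T n \<omega> ^ k * f (X T \<omega>) \<partial>P x)\<bar>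
         \<le> 6 * real k ^ 2 * C T * T ^ k * sup_norm h ^ k * (ln (real n) / real n) * sup_norm f"
proof (cases "k = 0")
  \<comment> \<open>For \<open>k = 0\<close> both expectations coincide and the right-hand side is
    0. For small \<open>n\<close> the argument below uses that \<open>k\<close> is at least
    1.\<close>
  case False
  interpret markov_process M P X by fact
  note T = \<open>T > 0\<close>
  have n: "n > 0" using \<open>n \<ge> 2\<close> by simp
  define H F where "H = sup_norm h" and "F = sup_norm f"
  have H: "\<bar>h y\<bar> \<le> H" and F: "\<bar>f y\<bar> \<le> F" for y
    using abs_le_sup_norm assms by (auto simp: H_def F_def)
  have HF0: "0 \<le> H ^ k * F" using H[of undefined] F[of undefined] by auto
  have CT: "1 \<le> C T" using assms by (intro condition_X_const_ge_1) auto
  then have C0: "0 \<le> C T" by simp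
  let ?N = "Pi\<^sub>M {..<k} (\<lambda>_. sample_time T)" and ?grid = "\<lambda>s. real (cell T n s) * T / real n"
  interpret N: prob_space ?N
    by (rule prob_space_PiM) (rule prob_space_sample_time[OF T])
  define D where "D \<theta> t = (\<integral>\<omega>. (\<Prod>i<k. h (X (\<theta> (t i)) \<omega>)) * f (X T \<omega>) \<partial>P x)" for \<theta> :: "real \<Rightarrow> real" and t
  have prod: "integrable ?N (D \<theta>)"
      "(\<integral>\<omega>. (\<integral>s. h (X (\<theta> s) \<omega>) \<partial>sample_time T) ^ k * f (X T \<omega>) \<partial>P x) = (\<integral>t. D \<theta> t \<partial>?N)"
      "\<bar>D \<theta> t\<bar> \<le> H ^ k * F"
    if "\<theta> \<in> borel_measurable borel" "\<And>s. 0 \<le> \<theta> s" for \<theta> t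
    unfolding D_def[abs_def] using power_expectation_eq_product[OF assms(2,4) H assms(6) F that T] by auto
  note prod_clip = prod[of "clip T", OF measurable_clip clip_bounds(1)[OF T]]
  have "?grid \<in> borel_measurable borel" by measurable
  moreover have "0 \<le> ?grid s" for s using T by simp
  ultimately have prod_grid: "integrable ?N (D ?grid)"
      "(\<integral>\<omega>. (\<integral>s. h (X (?grid s) \<omega>) \<partial>sample_time T) ^ k * f (X T \<omega>) \<partial>P x) = (\<integral>t. D ?grid t \<partial>?N)"
      "\<bar>D ?grid t\<bar> \<le> H ^ k * F" for t
    using prod[of ?grid] by blast+
  have "(\<integral>\<omega>. int_functional X h T \<omega> ^ k * f (X T \<omega>) \<partial>P x)
      = (\<integral>\<omega>. T ^ k * ((\<integral>s. h (X (clip T s) \<omega>) \<partial>sample_time T) ^ k * f (X T \<omega>)) \<partial>P x)"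
    using int_functional_eq_sample[OF assms(2,4) T]
    by (intro Bochner_Integration.integral_cong) (auto simp: space_P power_mult_distrib)
  also have "\<dots> = T ^ k * (\<integral>t. D (clip T) t \<partial>?N)"
    by (simp add: prod_clip(2))
  finally have lhs1: "(\<integral>\<omega>. int_functional X h T \<omega> ^ k * f (X T \<omega>) \<partial>P x) = T ^ k * (\<integral>t. D (clip T) t \<partial>?N)" .
  have "(\<integral>\<omega>. int_sum X h T n \<omega> ^ k * f (X T \<omega>) \<partial>P x)
      = (\<integral>\<omega>. T ^ k * ((\<integral>s. h (X (?grid s) \<omega>) \<partial>sample_time T) ^ k * f (X T \<omega>)) \<partial>P x)"
    by (simp add: int_sum_eq_sample[OF T n] power_mult_distrib mult.assoc)
  also have "\<dots> = T ^ k * (\<integral>t. D ?grid t \<partial>?N)"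
    by (simp add: prod_grid(2))
  finally have lhs2: "(\<integral>\<omega>. int_sum X h T n \<omega> ^ k * f (X T \<omega>) \<partial>P x) = T ^ k * (\<integral>t. D ?grid t \<partial>?N)" .
  let ?E = "\<bar>\<integral>t. D (clip T) t - D ?grid t \<partial>?N\<bar>"
  have int_diff: "integrable ?N (\<lambda>t. D (clip T) t - D ?grid t)"
    using prod_clip(1) prod_grid(1) by (rule Bochner_Integration.integrable_diff)
  have E_le: "?E \<le> (\<integral>t. \<bar>D (clip T) t - D ?grid t\<bar> \<partial>?N)"
    by (rule integral_abs_bound)
  have "?E \<le> H ^ k * F * (6 * real k ^ 2 * C T * (ln (real n) / real n))"
  proof (cases "n \<le> 4")
    case True
    have "\<bar>D (clip T) t - D ?grid t\<bar> \<le> H ^ k * F * 2" for t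
      using prod_clip(3)[of t] prod_grid(3)[of t] by linarith
    then have "(\<integral>t. \<bar>D (clip T) t - D ?grid t\<bar> \<partial>?N) \<le> H ^ k * F * 2"
      using int_diff by (intro N.integral_le_const) auto
    moreover have "2 \<le> 6 * real k ^ 2 * C T * (ln (real n) / real n)"
    proof -
      have "n \<in> {2, 3, 4}" using True \<open>n \<ge> 2\<close> by auto
      then have le: "2 \<le> 6 * (ln (real n) / real n)" by (rule two_le_six_log_ratio)
      have "1 \<le> real k ^ 2 * C T"
        using False CT mult_mono[of 1 "real k ^ 2" 1 "C T"] by simp
      from mult_mono[OF this le] C0 show ?thesis by (simp add: mult_ac)
    qed
    then have "H ^ k * F * 2 \<le> H ^ k * F * (6 * real k ^ 2 * C T * (ln (real n) / real n))"
      using HF0 by (rule mult_left_mono)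
    ultimately show ?thesis using E_le by linarith
  next
    case False
    define \<phi> where "\<phi> i t = (\<Sum>j\<in>{..<k} - {i}. cell_weight (C T) (cell T n (t i)) (cell T n (t j)))
        + cell_weight (C T) (cell T n (t i)) 0 + cell_weight (C T) (cell T n (t i)) n" for i and t :: "nat \<Rightarrow> real"
    note \<phi> = integral_cell_weight_sum_le[OF C0 T n, where k=k, folded \<phi>_def]
    have "(\<integral>t. \<bar>D (clip T) t - D ?grid t\<bar> \<partial>?N) \<le> (\<integral>t. H ^ k * F * (\<Sum>i<k. \<phi> i t) \<partial>?N)"
    proof (rule integral_mono)
      show "\<bar>D (clip T) t - D ?grid t\<bar> \<le> H ^ k * F * (\<Sum>i<k. \<phi> i t)" for t
        unfolding D_def \<phi>_def using assms(3) T n assms(4) H assms(6) F by (rule product_expectation_cell_le)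
    qed (use int_diff \<phi>(1) in auto)
    also have "\<dots> = H ^ k * F * (\<Sum>i<k. \<integral>t. \<phi> i t \<partial>?N)"
      using \<phi>(1) by simp
    \<comment> \<open>Each index \<open>i\<close> already costs a factor \<open>k\<close>; the sum
      over \<open>i\<close> supplies the second one.\<close>
    also have "\<dots> \<le> H ^ k * F * (\<Sum>i<k. real k * (2 * C T * (3 + ln (real n))) / real n)"
      using \<phi>(2) HF0 by (intro mult_left_mono sum_mono) auto
    also have "\<dots> = H ^ k * F * (real k ^ 2 * C T * (2 * (3 + ln (real n))) / real n)"
      by (simp add: power2_eq_square)
    also have "\<dots> \<le> H ^ k * F * (real k ^ 2 * C T * (6 * ln (real n)) / real n)"
      using three_plus_log_le[of n] False HF0 C0
      by (intro mult_left_mono divide_right_mono) auto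
    also have "\<dots> = H ^ k * F * (6 * real k ^ 2 * C T * (ln (real n) / real n))"
      by simp
    finally show ?thesis using E_le by linarith
  qed
  then have "T ^ k * ?E \<le> T ^ k * (H ^ k * F * (6 * real k ^ 2 * C T * (ln (real n) / real n)))"
    using T by (intro mult_left_mono) auto
  moreover have "T ^ k * ?E = \<bar>T ^ k * (\<integral>t. D (clip T) t \<partial>?N) - T ^ k * (\<integral>t. D ?grid t \<partial>?N)\<bar>"
    using prod_clip(1) prod_grid(1) T by (simp add: abs_mult flip: right_diff_distrib)
  ultimately show ?thesis
    unfolding lhs1 lhs2 by (simp add: H_def F_def mult_ac)
qed simp

end
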